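(* Let $t\geq 1$ be an integer, $\epsilon\in(0,1)$, and let $\mathcal{F}_1$ and $\mathcal{F}_2$ be two families of pseudo-discs in the plane with $|\mathcal{F}_1|=n$. Let $H$ be the hypergraph with vertex set $\mathcal{F}_1$ in which each $b \in \mathcal{F}_2$ defines the hyperedge $e_b=\{ a \in \mathcal{F}_1 : a \cap b \neq \emptyset \}$. If $\epsilon n \geq 2t$, then $H$ admits an $\epsilon$-$t$-net of size $O(t^5/\epsilon)$, where the implied constant is absolute.
   Context: A family of pseudo-discs is a family of simple closed Jordan regions in the plane such that the boundaries of any two members intersect in at most two points. For a hypergraph $H=(V,\mathcal{E})$ with $|V|=n$, an $\epsilon$-$t$-net is a set $N\subset\binom{V}{t}$ of $t$-tuples of vertices such that every hyperedge $e\in\mathcal{E}$ with $|e|\geq\epsilon n$ contains at least one $t$-tuple of $N$. *)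

theory Defs
  imports "HOL-Analysis.Analysis" "HOL-Library.Ramsey"
begin

(* The plane is complex, the type for which the library states the Jordan curve theorem. By that
   theorem the frontier of the region below is exactly the curve path_image c. *)
definition jordan_region :: "complex set \<Rightarrow> bool" where
  "jordan_region D \<longleftrightarrow>
     (\<exists>c. simple_path c \<and> pathfinish c = pathstart c \<and>
          D = path_image c \<union> inside (path_image c))"

definition pseudo_discs :: "complex set set \<Rightarrow> bool" where
  "pseudo_discs F \<longleftrightarrow>
     (\<forall>D\<in>F. jordan_region D) \<and>
     (\<forall>A\<in>F. \<forall>B\<in>F. A \<noteq> B \<longrightarrow>
        finite (frontier A \<inter> frontier B) \<and> card (frontier A \<inter> frontier B) \<le> 2)"

type_synonym 'a hypergraph = "'a set \<times> 'a set set"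

definition intersection_hypergraph :: "'a set set \<Rightarrow> 'a set set \<Rightarrow> 'a set hypergraph" where
  "intersection_hypergraph F1 F2 = (F1, (\<lambda>b. {a \<in> F1. a \<inter> b \<noteq> {}}) ` F2)"

(* Meant for finite vertex sets, where card is the true cardinality; the members of a net are
   unordered t-element sets of vertices. *)
definition eps_t_net :: "real \<Rightarrow> nat \<Rightarrow> 'a hypergraph \<Rightarrow> 'a set set \<Rightarrow> bool" where
  "eps_t_net \<epsilon> t H N \<longleftrightarrow>
     N \<subseteq> nsets (fst H) t \<and>
     (\<forall>e\<in>snd H. real (card e) \<ge> \<epsilon> * real (card (fst H)) \<longrightarrow> (\<exists>S\<in>N. S \<subseteq> e))"

end

theory Submission
  imports Defs "HOL-Complex_Analysis.Winding_Numbers"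
begin

text \<open>
  For a subfamily \<open>V\<close> of \<open>F1\<close> call two members adjacent if some member of \<open>F2\<close> meets exactly these
  two members of \<open>V\<close>. If five disjoint groups of members of \<open>V\<close>, each containing an adjacent pair,
  were connected and pairwise joined by adjacencies, one could draw a complete graph on five points
  with edges running through the corresponding discs. By Janiszewski's theorem the difference
  \<open>A - B\<close> of two pseudo-discs is connected unless \<open>B\<close> lies inside \<open>A\<close>. So a path in \<open>A\<close> whose end
  points avoid \<open>B\<close> can be moved off \<open>B\<close>, and two paths inside two pseudo-discs whose end points avoid
  the other disc have algebraic crossing number zero. All independent edges of the drawing would then
  cross zero times algebraically, which a parity argument excludes. Hence the adjacency graph has no
  clique minor on ten vertices and, by Mader's theorem, linearly many edges; the same argument shows
  that no five members of \<open>F1\<close> are shattered.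

  The rest uses only these two facts. Clarkson--Shor sampling makes the graph of pairs lying in a
  common hyperedge of size at most \<open>m\<close> have \<open>O(m n)\<close> edges for every induced subgraph, and as every
  family of sets shatters at least as many sets as it has members, there are \<open>O(n m\<^sup>3)\<close> hyperedges
  of size at most \<open>m\<close>. Haussler's packing argument then gives a family of \<open>O(t\<^sup>4 n / k)\<close> hyperedges
  of size about \<open>k\<close> such that all others of that size differ from one of them in less than
  \<open>k / (4 t)\<close> elements. Inside each of these, \<open>O(t)\<close> sets of size \<open>t\<close> suffice, by double sampling.
  The sizes \<open>k = 2\<^sup>j \<epsilon> n\<close> contribute a geometric series.
\<close>

section \<open>Crossing numbers of paths\<close>

text \<open>The winding number around \<open>0\<close> of \<open>\<gamma> s - \<delta> t\<close> as \<open>(s,t)\<close> runs along the boundary of the unit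
  square, that is, the algebraic number of crossings of \<open>\<gamma>\<close> and \<open>\<delta>\<close>. It is meaningful only if no
  end point of one path lies on the other.\<close>

definition crossing :: "(real \<Rightarrow> complex) \<Rightarrow> (real \<Rightarrow> complex) \<Rightarrow> complex" where
  "crossing \<gamma> \<delta> =
     winding_number \<gamma> (pathstart \<delta>) + winding_number \<delta> (pathfinish \<gamma>)
     - winding_number \<gamma> (pathfinish \<delta>) - winding_number \<delta> (pathstart \<gamma>)"

definition unlinked :: "(real \<Rightarrow> complex) \<Rightarrow> (real \<Rightarrow> complex) \<Rightarrow> bool" where
  "unlinked \<gamma> \<delta> \<longleftrightarrow> path \<gamma> \<and> path \<delta> \<and>
     pathstart \<delta> \<notin> path_image \<gamma> \<and> pathfinish \<delta> \<notin> path_image \<gamma> \<and>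
     pathstart \<gamma> \<notin> path_image \<delta> \<and> pathfinish \<gamma> \<notin> path_image \<delta> \<and> crossing \<gamma> \<delta> = 0"

lemma unlinked_sym: "unlinked \<gamma> \<delta> \<Longrightarrow> unlinked \<delta> \<gamma>"
  by (auto simp: unlinked_def crossing_def algebra_simps)

lemma unlinked_join:
  assumes "unlinked \<gamma> \<delta>" "unlinked \<gamma>' \<delta>" "pathfinish \<gamma> = pathstart \<gamma>'"
  shows "unlinked (\<gamma> +++ \<gamma>') \<delta>"
proof -
  have "winding_number (\<gamma> +++ \<gamma>') z = winding_number \<gamma> z + winding_number \<gamma>' z"
    if "z \<in> {pathstart \<delta>, pathfinish \<delta>}" for z
    using assms that by (auto simp: unlinked_def winding_number_join)
  then have "crossing (\<gamma> +++ \<gamma>') \<delta> = crossing \<gamma> \<delta> + crossing \<gamma>' \<delta>"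
    by (simp add: crossing_def assms(3))
  then show ?thesis
    using assms by (simp add: unlinked_def path_image_join)
qed

lemma winding_number_continuous_log:
  assumes "continuous_on {0..1} l" "\<And>s. s \<in> {0..1} \<Longrightarrow> \<gamma> s - z = exp (l s)"
  shows "winding_number \<gamma> z = (l 1 - l 0) / (2 * of_real pi * \<i>)"
proof -
  have "winding_number \<gamma> z = winding_number (\<lambda>s. \<gamma> s - z) 0"
    by (rule winding_number_offset)
  also have "\<dots> = winding_number (exp \<circ> l) 0"
    by (rule winding_number_cong) (use assms(2) in auto)
  also have "\<dots> = (l 1 - l 0) / (2 * of_real pi * \<i>)"
    using winding_number_compose_exp[of l] assms(1)
    by (simp add: path_def pathstart_def pathfinish_def)
  finally show ?thesis .
qed

lemma continuous_log_diff_of_disjoint_paths: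
  fixes \<gamma> \<delta> :: "real \<Rightarrow> complex"
  assumes "path \<gamma>" "path \<delta>" "path_image \<gamma> \<inter> path_image \<delta> = {}"
  obtains L where "continuous_on ({0..1} \<times> {0..1}) L"
    "\<And>s t. s \<in> {0..1} \<Longrightarrow> t \<in> {0..1} \<Longrightarrow> \<gamma> s - \<delta> t = exp (L (s,t))"
proof -
  let ?Q = "{0..1::real} \<times> {0..1::real}"
  have "continuous_on ?Q (\<lambda>x. \<gamma> (fst x) - \<delta> (snd x))"
    using assms unfolding path_def
    by (auto intro!: continuous_on_diff continuous_on_compose2[of "{0..1}" \<gamma> _ fst]
          continuous_on_compose2[of "{0..1}" \<delta> _ snd] continuous_intros)
  moreover have "contractible ?Q"
    by (intro convex_imp_contractible convex_Times) auto
  moreover have "\<gamma> (fst x) - \<delta> (snd x) \<noteq> 0" if "x \<in> ?Q" for x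
    using that assms(3) by (force simp: path_image_def)
  ultimately obtain L where "continuous_on ?Q L"
      "\<And>x. x \<in> ?Q \<Longrightarrow> \<gamma> (fst x) - \<delta> (snd x) = exp (L x)"
    by (rule continuous_logarithm_on_contractible) blast+
  then show thesis by (intro that[of L]) force+
qed

lemma crossing_disjoint:
  assumes "path \<gamma>" "path \<delta>" "path_image \<gamma> \<inter> path_image \<delta> = {}"
  shows "crossing \<gamma> \<delta> = 0"
proof -
  obtain L where cont: "continuous_on ({0..1} \<times> {0..1}) L"
    and log: "\<And>s t. s \<in> {0..1} \<Longrightarrow> t \<in> {0..1} \<Longrightarrow> \<gamma> s - \<delta> t = exp (L (s,t))"
    using continuous_log_diff_of_disjoint_paths[OF assms] by blast
  have "winding_number \<gamma> (\<delta> t) = (L (1,t) - L (0,t)) / (2 * of_real pi * \<i>)" if "t \<in> {0..1}" for t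
    using that log
    by (intro winding_number_continuous_log[of "\<lambda>s. L (s,t)"] continuous_on_compose2[OF cont]
          continuous_intros) auto
  moreover have "winding_number \<delta> (\<gamma> s) = (L (s,1) - L (s,0)) / (2 * of_real pi * \<i>)"
    if s: "s \<in> {0..1}" for s
  proof -
    have "\<delta> t - \<gamma> s = exp (L (s,t) + of_real pi * \<i>)" if "t \<in> {0..1}" for t
      using log[OF s that] by (simp add: exp_add) (metis minus_diff_eq)
    then show ?thesis
      using s by (subst winding_number_continuous_log[of "\<lambda>t. L (s,t) + of_real pi * \<i>"])
        (auto intro!: continuous_on_compose2[OF cont] continuous_intros)
  qed
  ultimately show ?thesis
    unfolding crossing_def pathstart_def pathfinish_def by (simp add: diff_divide_distrib)
qed

lemma unlinked_disjoint:
  assumes "path \<gamma>" "path \<delta>" "path_image \<gamma> \<inter> path_image \<delta> = {}"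
  shows "unlinked \<gamma> \<delta>"
proof -
  have "pathstart \<gamma> \<in> path_image \<gamma>" "pathfinish \<gamma> \<in> path_image \<gamma>"
    "pathstart \<delta> \<in> path_image \<delta>" "pathfinish \<delta> \<in> path_image \<delta>" by auto
  then show ?thesis
    using assms crossing_disjoint[OF assms] unfolding unlinked_def by blast
qed

section \<open>Parity of drawings of the complete graph\<close>

text \<open>The winding number in excess of the one computed with the principal branch of the logarithm;
  it is an integer, so that rounding has no effect.\<close>

definition excess :: "(real \<Rightarrow> complex) \<Rightarrow> complex \<Rightarrow> int" where
  "excess \<gamma> z = round (Re (winding_number \<gamma> z
     - (Ln (pathfinish \<gamma> - z) - Ln (pathstart \<gamma> - z)) / (2 * of_real pi * \<i>)))"

lemma winding_number_eq_excess:
  assumes "path \<gamma>" "z \<notin> path_image \<gamma>"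
  shows "winding_number \<gamma> z
    = (Ln (pathfinish \<gamma> - z) - Ln (pathstart \<gamma> - z)) / (2 * of_real pi * \<i>) + of_int (excess \<gamma> z)"
proof -
  have "pathstart \<gamma> - z \<noteq> 0" "pathfinish \<gamma> - z \<noteq> 0"
    using assms(2) by (metis eq_iff_diff_eq_0 pathstart_in_path_image pathfinish_in_path_image)+
  then have "exp (2 * of_real pi * \<i> * winding_number \<gamma> z)
      = exp (Ln (pathfinish \<gamma> - z) - Ln (pathstart \<gamma> - z))"
    using winding_number_exp_2pi[OF assms] by (simp add: exp_diff)
  then obtain n :: int where "2 * of_real pi * \<i> * winding_number \<gamma> z
      = Ln (pathfinish \<gamma> - z) - Ln (pathstart \<gamma> - z) + of_real (real_of_int (2 * n) * pi) * \<i>"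
    unfolding exp_eq by blast
  then have n: "winding_number \<gamma> z
      = (Ln (pathfinish \<gamma> - z) - Ln (pathstart \<gamma> - z)) / (2 * of_real pi * \<i>) + of_int n"
    by (simp add: field_simps)
  then have "excess \<gamma> z = n" by (simp add: excess_def)
  then show ?thesis using n by simp
qed

definition branch_jump :: "complex \<Rightarrow> int" where
  "branch_jump z = (if Im z \<le> 0 \<and> \<not> (Re z < 0 \<and> Im z = 0) then 0 else - 1)"

lemma Ln_minus_branch_jump:
  "z \<noteq> 0 \<Longrightarrow> Ln (- z) / (2 * of_real pi * \<i>)
    = Ln z / (2 * of_real pi * \<i>) + 1 / 2 + of_int (branch_jump z)"
  by (auto simp: Ln_minus branch_jump_def field_simps)

lemma branch_jump_minus: "z \<noteq> 0 \<Longrightarrow> branch_jump (- z) = - 1 - branch_jump z"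
  by (auto simp: branch_jump_def complex_eq_iff)

lemma unlinked_imp_even:
  assumes "unlinked \<gamma> \<delta>"
    and "pathstart \<gamma> = a" "pathfinish \<gamma> = b" "pathstart \<delta> = c" "pathfinish \<delta> = d"
  shows "even (excess \<gamma> c + excess \<gamma> d + excess \<delta> a + excess \<delta> b
    + branch_jump (a - c) + branch_jump (a - d) + branch_jump (b - c) + branch_jump (b - d))"
proof -
  let ?l = "\<lambda>z. Ln z / (2 * of_real pi * \<i>)"
  have paths: "path \<gamma>" "path \<delta>" "c \<notin> path_image \<gamma>" "d \<notin> path_image \<gamma>" "a \<notin> path_image \<delta>"
    "b \<notin> path_image \<delta>" and "crossing \<gamma> \<delta> = 0"
    using assms by (auto simp: unlinked_def)
  have "a \<noteq> c" "a \<noteq> d" "b \<noteq> c" "b \<noteq> d"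
    using assms paths by (metis pathstart_in_path_image pathfinish_in_path_image)+
  then have turn: "?l (z - w) = ?l (w - z) + 1 / 2 + of_int (branch_jump (w - z))"
    if "w \<in> {a,b}" "z \<in> {c,d}" for w z
    using that Ln_minus_branch_jump[of "w - z"] by auto
  have "0 = (?l (b - c) - ?l (a - c) + of_int (excess \<gamma> c))
      + (?l (d - b) - ?l (c - b) + of_int (excess \<delta> b))
      - (?l (b - d) - ?l (a - d) + of_int (excess \<gamma> d))
      - (?l (d - a) - ?l (c - a) + of_int (excess \<delta> a))"
    using \<open>crossing \<gamma> \<delta> = 0\<close> winding_number_eq_excess[OF paths(1,3)]
      winding_number_eq_excess[OF paths(1,4)] winding_number_eq_excess[OF paths(2,5)]
      winding_number_eq_excess[OF paths(2,6)] assms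
    by (simp add: crossing_def diff_divide_distrib)
  also have "\<dots> = of_int (excess \<gamma> c + excess \<delta> b - excess \<gamma> d - excess \<delta> a
      + branch_jump (b - d) - branch_jump (b - c) - branch_jump (a - d) + branch_jump (a - c))"
    using turn[of b d] turn[of b c] turn[of a d] turn[of a c] by simp
  finally have "excess \<gamma> c + excess \<delta> b - excess \<gamma> d - excess \<delta> a
      + branch_jump (b - d) - branch_jump (b - c) - branch_jump (a - d) + branch_jump (a - c) = 0"
    by (metis of_int_eq_0_iff)
  then have "excess \<gamma> c + excess \<gamma> d + excess \<delta> a + excess \<delta> b
      + branch_jump (a - c) + branch_jump (a - d) + branch_jump (b - c) + branch_jump (b - d)
    = 2 * (excess \<gamma> d + excess \<delta> a + branch_jump (b - c) + branch_jump (a - d))"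
    by algebra
  then show ?thesis by (metis dvd_triv_left)
qed

locale unlinked_drawing =
  fixes n :: nat and P :: "nat \<Rightarrow> complex" and p :: "nat \<Rightarrow> nat \<Rightarrow> real \<Rightarrow> complex"
  assumes ends: "i < j \<Longrightarrow> j < n \<Longrightarrow> pathstart (p i j) = P i \<and> pathfinish (p i j) = P j"
    and independent_unlinked:
      "i < j \<Longrightarrow> j < n \<Longrightarrow> k < l \<Longrightarrow> l < n \<Longrightarrow> {i,j} \<inter> {k,l} = {} \<Longrightarrow> unlinked (p i j) (p k l)"
begin

abbreviation edge_excess :: "nat \<Rightarrow> nat \<Rightarrow> nat \<Rightarrow> int" where
  "edge_excess i j k \<equiv> excess (p i j) (P k)"

definition K4_excess :: "nat \<Rightarrow> nat \<Rightarrow> nat \<Rightarrow> nat \<Rightarrow> int" where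
  "K4_excess w x y z =
     edge_excess w x y + edge_excess w x z + edge_excess y z w + edge_excess y z x
     + edge_excess w y x + edge_excess w y z + edge_excess x z w + edge_excess x z y
     + edge_excess w z x + edge_excess w z y + edge_excess x y w + edge_excess x y z"

lemma independent_edges_even:
  assumes "i < j" "j < n" "k < l" "l < n" "{i,j} \<inter> {k,l} = {}"
  shows "even (edge_excess i j k + edge_excess i j l + edge_excess k l i + edge_excess k l j
    + branch_jump (P i - P k) + branch_jump (P i - P l)
    + branch_jump (P j - P k) + branch_jump (P j - P l))"
  using unlinked_imp_even[OF independent_unlinked[OF assms]] ends[OF assms(1,2)] ends[OF assms(3,4)]
  by blast

lemma vertices_distinct:
  assumes "i < j" "j < n" "k < l" "l < n" "{i,j} \<inter> {k,l} = {}"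
  shows "P i \<noteq> P k" "P i \<noteq> P l" "P j \<noteq> P k" "P j \<noteq> P l"
  using independent_unlinked[OF assms] ends[OF assms(1,2)] ends[OF assms(3,4)]
  unfolding unlinked_def by (metis pathstart_in_path_image pathfinish_in_path_image)+

text \<open>In the sum over the three pairs of opposite edges every vertex pair contributes two branch
  jumps, three of them between the vertices in reversed order.\<close>

lemma odd_K4_excess:
  assumes "w < x" "x < y" "y < z" "z < n"
  shows "odd (K4_excess w x y z)"
proof -
  let ?b = "\<lambda>i j. branch_jump (P i - P j)"
  have reversed: "?b y x = - 1 - ?b x y" "?b z x = - 1 - ?b x z" "?b z y = - 1 - ?b y z"
    using branch_jump_minus[of "P x - P y"] branch_jump_minus[of "P x - P z"]
      branch_jump_minus[of "P y - P z"] vertices_distinct[of w x y z] vertices_distinct[of w y x z]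
      assms by auto
  have even: "even (edge_excess w x y + edge_excess w x z + edge_excess y z w + edge_excess y z x
      + ?b w y + ?b w z + ?b x y + ?b x z)"
    "even (edge_excess w y x + edge_excess w y z + edge_excess x z w + edge_excess x z y
      + ?b w x + ?b w z + ?b y x + ?b y z)"
    "even (edge_excess w z x + edge_excess w z y + edge_excess x y w + edge_excess x y z
      + ?b w x + ?b w y + ?b z x + ?b z y)"
    by (intro independent_edges_even; use assms in auto)+
  have "K4_excess w x y z + 2 * (?b w x + ?b w y + ?b w z) - 3 =
      (edge_excess w x y + edge_excess w x z + edge_excess y z w + edge_excess y z x
      + ?b w y + ?b w z + ?b x y + ?b x z)
    + (edge_excess w y x + edge_excess w y z + edge_excess x z w + edge_excess x z y
      + ?b w x + ?b w z + ?b y x + ?b y z)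
    + (edge_excess w z x + edge_excess w z y + edge_excess x y w + edge_excess x y z
      + ?b w x + ?b w y + ?b z x + ?b z y)"
    unfolding K4_excess_def reversed by simp
  also have "even \<dots>" by (rule dvd_add[OF dvd_add[OF even(1,2)] even(3)])
  finally show ?thesis by simp
qed

text \<open>An edge and a vertex off it lie together in two of the five complete graphs on four
  vertices.\<close>

lemma order_less_5: "n < 5"
proof (rule ccontr)
  assume "\<not> n < 5"
  then have "odd (K4_excess 0 1 2 3 + K4_excess 0 1 2 4 + K4_excess 0 1 3 4 + K4_excess 0 2 3 4
      + K4_excess 1 2 3 4)"
    using odd_K4_excess[of 0 1 2 3] odd_K4_excess[of 0 1 2 4] odd_K4_excess[of 0 1 3 4]
      odd_K4_excess[of 0 2 3 4] odd_K4_excess[of 1 2 3 4] by simp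
  moreover have "K4_excess 0 1 2 3 + K4_excess 0 1 2 4 + K4_excess 0 1 3 4 + K4_excess 0 2 3 4
      + K4_excess 1 2 3 4
    = 2 * (edge_excess 0 1 2 + edge_excess 0 1 3 + edge_excess 0 1 4 + edge_excess 0 2 1
        + edge_excess 0 2 3 + edge_excess 0 2 4 + edge_excess 0 3 1 + edge_excess 0 3 2
        + edge_excess 0 3 4 + edge_excess 0 4 1 + edge_excess 0 4 2 + edge_excess 0 4 3
        + edge_excess 1 2 0 + edge_excess 1 2 3 + edge_excess 1 2 4 + edge_excess 1 3 0
        + edge_excess 1 3 2 + edge_excess 1 3 4 + edge_excess 1 4 0 + edge_excess 1 4 2
        + edge_excess 1 4 3 + edge_excess 2 3 0 + edge_excess 2 3 1 + edge_excess 2 3 4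
        + edge_excess 2 4 0 + edge_excess 2 4 1 + edge_excess 2 4 3 + edge_excess 3 4 0
        + edge_excess 3 4 1 + edge_excess 3 4 2)"
    by (simp add: K4_excess_def)
  ultimately show False by (metis dvd_triv_left)
qed

end

section \<open>Jordan regions\<close>

lemma jordan_regionE:
  assumes "jordan_region D"
  obtains c where "simple_path c" "pathfinish c = pathstart c" "frontier D = path_image c"
    "interior D = inside (path_image c)" "- D = outside (path_image c)"
    "closure (inside (path_image c)) = D"
proof -
  obtain c where c: "simple_path c" "pathfinish c = pathstart c"
    and D: "D = path_image c \<union> inside (path_image c)"
    using assms unfolding jordan_region_def by blast
  note J = Jordan_inside_outside[OF c]
  have outside: "- D = outside (path_image c)"
    using J D by blast
  have closure: "closure (inside (path_image c)) = D"
    using J D by (metis closure_Un_frontier sup_commute)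
  have "interior D = - closure (outside (path_image c))"
    using closure_complement[of D] outside by simp
  also have "\<dots> = - (outside (path_image c) \<union> path_image c)"
    using J by (metis closure_Un_frontier)
  also have "\<dots> = inside (path_image c)"
    using J by blast
  finally have interior: "interior D = inside (path_image c)" .
  have "closure D = D" using closure closure_closure by metis
  then have "frontier D = path_image c"
    using D interior inside_no_overlap[of "path_image c"] unfolding frontier_def by blast
  then show ?thesis
    using that c interior outside closure by blast
qed

lemma closure_interior_jordan_region: "jordan_region D \<Longrightarrow> closure (interior D) = D"
  by (metis jordan_regionE)

lemma compact_jordan_region: "jordan_region D \<Longrightarrow> compact D"
  by (metis jordan_regionE Jordan_inside_outside bounded_closure closed_closure
      compact_eq_bounded_closed)

lemma closed_jordan_region: "jordan_region D \<Longrightarrow> closed D"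
  by (simp add: compact_jordan_region compact_imp_closed)

lemma connected_interior_jordan_region: "jordan_region D \<Longrightarrow> connected (interior D)"
  by (metis jordan_regionE Jordan_inside_outside)

lemma interior_jordan_region_nonempty: "jordan_region D \<Longrightarrow> interior D \<noteq> {}"
  by (metis jordan_regionE Jordan_inside_outside)

lemma connected_Compl_jordan_region: "jordan_region D \<Longrightarrow> connected (- D)"
  by (metis jordan_regionE Jordan_inside_outside)

lemma unbounded_Compl_jordan_region: "jordan_region D \<Longrightarrow> \<not> bounded (- D)"
  by (metis jordan_regionE Jordan_inside_outside)

lemma path_connected_Compl_jordan_region: "jordan_region D \<Longrightarrow> path_connected (- D)"
  by (simp add: closed_jordan_region connected_Compl_jordan_region connected_open_path_connected
      open_Compl)

lemma infinite_frontier_jordan_region: "jordan_region D \<Longrightarrow> infinite (frontier D)"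
  by (metis jordan_regionE simple_path_image_uncountable uncountable_infinite)

lemma jordan_region_not_subset_bounded:
  assumes "jordan_region D" "bounded S"
  shows "\<not> - D \<subseteq> S"
  using assms unbounded_Compl_jordan_region bounded_subset by blast

lemma path_connected_jordan_region:
  assumes D: "jordan_region D"
  shows "path_connected D"
proof -
  obtain z where z: "z \<in> interior D" using interior_jordan_region_nonempty[OF D] by blast
  obtain y where y: "y \<notin> D"
    using jordan_region_not_subset_bounded[OF D, of "{}"] by blast
  obtain h where h: "path h" "pathstart h = z" "path_image h - {pathfinish h} \<subseteq> interior D"
    "pathfinish h \<in> frontier D"
    using exists_path_subpath_to_frontier[of "linepath z y" D] y z interior_subset closure_subset
    by (metis (no_types, lifting) path_linepath pathfinish_linepath pathstart_linepath subsetD)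
  have "path_connected (interior D)"
    by (simp add: connected_interior_jordan_region[OF D] connected_open_path_connected)
  moreover have "path_connected (frontier D)"
    using D by (metis jordan_regionE path_connected_path_image simple_path_imp_path)
  ultimately have "path_connected (interior D \<union> path_image h \<union> frontier D)"
    using h z by (intro path_connected_Un path_connected_path_image) auto
  moreover have "interior D \<union> path_image h \<union> frontier D = D"
    using h(3,4) closed_jordan_region[OF D] interior_subset[of D] by (auto simp: frontier_def)
  ultimately show ?thesis by simp
qed

lemma connected_disjoint_frontier:
  assumes "connected S" "S \<inter> frontier D = {}"
  shows "S \<subseteq> interior D \<or> S \<subseteq> - D"
  using connected_Int_frontier[of S D] assms closure_subset[of D] unfolding frontier_def by blast

lemma jordan_region_subset_if_frontier_subset:
  assumes "jordan_region A" "jordan_region B" "frontier B \<subseteq> A"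
  shows "B \<subseteq> A"
proof -
  have "\<not> - A \<subseteq> interior B"
    using compact_jordan_region[OF assms(2)] interior_subset assms(1)
    by (metis jordan_region_not_subset_bounded bounded_subset compact_imp_bounded)
  then show ?thesis
    using connected_disjoint_frontier[OF connected_Compl_jordan_region[OF assms(1)], of B] assms(3)
    by blast
qed

lemma arc_subset_closure_endless:
  fixes u :: "real \<Rightarrow> 'a::t2_space"
  assumes "arc u"
  shows "path_image u \<subseteq> closure (path_image u - {pathstart u, pathfinish u})"
proof -
  have endless: "path_image u - {pathstart u, pathfinish u} = u ` {0<..<1}"
    using simple_path_endless[OF arc_imp_simple_path[OF assms]] .
  have "u ` closure {0<..<1} \<subseteq> closure (u ` {0<..<1})"
    by (rule image_closure_subset[OF _ closed_closure closure_subset])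
      (use assms in \<open>simp add: arc_def path_def\<close>)
  then show ?thesis
    unfolding endless by (simp add: path_image_def)
qed

lemma arc_inside_or_outside_jordan_region:
  assumes A: "jordan_region A" and v: "arc v" "pathstart v = p" "pathfinish v = q"
    and meets: "path_image v \<inter> frontier A \<subseteq> {p,q}"
  shows "path_image v \<inter> interior A = {} \<or> path_image v \<subseteq> A \<and> path_image v - {p,q} \<subseteq> interior A"
proof -
  have closure: "path_image v \<subseteq> closure (path_image v - {p,q})"
    using arc_subset_closure_endless[OF v(1)] v(2,3) by simp
  have "connected (path_image v - {p,q})"
    using connected_simple_path_endless[OF arc_imp_simple_path[OF v(1)]] v(2,3) by simp
  then consider "path_image v - {p,q} \<subseteq> interior A" | "path_image v - {p,q} \<subseteq> - A"
    using connected_disjoint_frontier[of "path_image v - {p,q}" A] meets by blast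
  then show ?thesis
  proof cases
    case 1
    then show ?thesis
      using closure closure_mono[OF 1] unfolding closure_interior_jordan_region[OF A] by blast
  next
    case 2
    then show ?thesis
      using closure closure_mono[OF 2] unfolding closure_complement by blast
  qed
qed

section \<open>Differences of pseudo-discs\<close>

lemma pseudo_discs_subset: "pseudo_discs F \<Longrightarrow> G \<subseteq> F \<Longrightarrow> pseudo_discs G"
  unfolding pseudo_discs_def by (meson subsetD)

lemma pseudo_discs_imp_jordan_region: "pseudo_discs F \<Longrightarrow> A \<in> F \<Longrightarrow> jordan_region A"
  unfolding pseudo_discs_def by blast

lemma infinite_superset_two_points:
  assumes "infinite S" "K \<subseteq> S" "finite K" "card K \<le> 2"
  obtains p q where "p \<noteq> q" "p \<in> S" "q \<in> S" "K \<subseteq> {p,q}"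
proof -
  obtain L where L: "finite L" "card L = 2" "L \<subseteq> S"
    using infinite_arbitrarily_large[OF assms(1)] by blast
  then have "2 \<le> card (K \<union> L)"
    using assms(3) card_mono[of "K \<union> L" L] by simp
  then obtain T where T: "K \<subseteq> T" "T \<subseteq> K \<union> L" "card T = 2"
    using exists_subset_between[OF assms(4), of "K \<union> L"] assms(3) L(1) by auto
  then obtain p q where pq: "T = {p,q}" "p \<noteq> q" by (meson card_2_iff)
  have "T \<subseteq> S" using T(2) L(3) assms(2) by blast
  then show ?thesis using that[of p q] pq T(1) by simp
qed

text \<open>The common boundary points split the boundary of \<open>B\<close> into two arcs, each of which runs inside
  or outside \<open>A\<close>.\<close>

lemma pseudo_discs_frontier_split:
  assumes "pseudo_discs {A,B}" "A \<noteq> B"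
  obtains U W where "U \<union> W = frontier B" "U \<inter> W \<noteq> {}" "connected U" "connected W"
    "U \<inter> interior A = {} \<or> U \<subseteq> A \<and> U - W \<subseteq> interior A"
    "W \<inter> interior A = {} \<or> W \<subseteq> A \<and> W - U \<subseteq> interior A"
proof -
  have A: "jordan_region A" and B: "jordan_region B"
    and "finite (frontier A \<inter> frontier B)" "card (frontier A \<inter> frontier B) \<le> 2"
    using assms by (simp_all add: pseudo_discs_def)
  then obtain p q where pq: "p \<noteq> q" "p \<in> frontier B" "q \<in> frontier B"
      "frontier A \<inter> frontier B \<subseteq> {p,q}"
    using infinite_superset_two_points[OF infinite_frontier_jordan_region[OF B],
        of "frontier A \<inter> frontier B"] by blast
  obtain c where c: "simple_path c" "pathfinish c = pathstart c" "frontier B = path_image c"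
    using jordan_regionE[OF B] by metis
  obtain u d where arcs: "arc u" "arc d" "pathstart u = p" "pathfinish u = q"
    "pathstart d = q" "pathfinish d = p" and common: "path_image u \<inter> path_image d = {p,q}"
    and frontier_B: "path_image u \<union> path_image d = frontier B"
    by (rule exists_double_arc[OF c(1,2) pq(2,3)[unfolded c(3)] pq(1)]) (simp add: c(3))
  have minus: "path_image u - {p,q} = path_image u - path_image d"
    "path_image d - {q,p} = path_image d - path_image u"
    using common by blast+
  show ?thesis
  proof (rule that[OF frontier_B])
    show "path_image u \<inter> path_image d \<noteq> {}" using common by simp
    show "connected (path_image u)" "connected (path_image d)"
      using arcs(1,2) by (simp_all add: connected_arc_image)
    show "path_image u \<inter> interior A = {} \<or>
        path_image u \<subseteq> A \<and> path_image u - path_image d \<subseteq> interior A"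
      using pq(4) frontier_B unfolding minus[symmetric]
      by (intro arc_inside_or_outside_jordan_region[OF A arcs(1,3,4)]) blast
    show "path_image d \<inter> interior A = {} \<or>
        path_image d \<subseteq> A \<and> path_image d - path_image u \<subseteq> interior A"
      using pq(4) frontier_B unfolding minus[symmetric]
      by (intro arc_inside_or_outside_jordan_region[OF A arcs(2,5,6)]) blast
  qed
qed

lemma connected_frontier_Diff_interior:
  assumes pd: "pseudo_discs {A,B}" and "\<not> B \<subseteq> A"
  shows "connected (frontier B - interior A)"
proof -
  have "jordan_region A" "jordan_region B" using pd by (simp_all add: pseudo_discs_def)
  then have not_subset: "\<not> frontier B \<subseteq> A"
    using jordan_region_subset_if_frontier_subset assms(2) by blast
  have "A \<noteq> B" using assms(2) by blast
  with pd obtain U W where UW: "U \<union> W = frontier B" "U \<inter> W \<noteq> {}" "connected U" "connected W"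
    and U: "U \<inter> interior A = {} \<or> U \<subseteq> A \<and> U - W \<subseteq> interior A"
    and W: "W \<inter> interior A = {} \<or> W \<subseteq> A \<and> W - U \<subseteq> interior A"
    by (rule pseudo_discs_frontier_split)
  consider "U \<inter> interior A = {}" "W \<inter> interior A = {}"
    | "U \<inter> interior A = {}" "W - U \<subseteq> interior A" | "W \<inter> interior A = {}" "U - W \<subseteq> interior A"
    using U W not_subset unfolding UW(1)[symmetric] by auto
  then show ?thesis
  proof cases
    case 1
    then have "frontier B - interior A = U \<union> W" unfolding UW(1)[symmetric] by blast
    then show ?thesis using connected_Un[OF UW(3,4,2)] by simp
  next
    case 2
    then have "frontier B - interior A = U" unfolding UW(1)[symmetric] by blast
    then show ?thesis using UW(3) by simp
  next
    case 3
    then have "frontier B - interior A = W" unfolding UW(1)[symmetric] by blast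
    then show ?thesis using UW(4) by simp
  qed
qed

lemma connected_set_to_frontier:
  assumes A: "jordan_region A" and B: "jordan_region B" and x: "x \<in> B - A"
  obtains K where "connected K" "x \<in> K" "K \<subseteq> B - A" "K \<inter> frontier B \<noteq> {}"
proof -
  obtain y where "y \<notin> A" "y \<notin> B"
    using jordan_region_not_subset_bounded[OF A, of B] compact_jordan_region[OF B]
      compact_imp_bounded by blast
  then obtain g where g: "path g" "path_image g \<subseteq> - A" "pathstart g = x" "pathfinish g \<notin> B"
    using path_connected_Compl_jordan_region[OF A] x unfolding path_connected_def
    by (metis ComplI DiffD2)
  then obtain h where h: "path h" "pathstart h = x" "path_image h \<subseteq> path_image g \<inter> B"
      "pathfinish h \<in> frontier B"
    using exists_path_subpath_to_frontier_closed[OF closed_jordan_region[OF B], of g] x by blast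
  show ?thesis
  proof (rule that)
    show "connected (path_image h)" by (rule connected_path_image[OF h(1)])
    show "x \<in> path_image h" using pathstart_in_path_image[of h] h(2) by simp
    show "path_image h \<subseteq> B - A" using h(3) g(2) by blast
    show "path_image h \<inter> frontier B \<noteq> {}" using pathfinish_in_path_image[of h] h(4) by blast
  qed
qed

lemma connected_Diff_interior:
  assumes pd: "pseudo_discs {A,B}" and "\<not> B \<subseteq> A"
  shows "connected (B - interior A)"
proof (rule connected_intermediate_closure)
  have A: "jordan_region A" and B: "jordan_region B"
    using pd by (simp_all add: pseudo_discs_def)
  let ?rim = "frontier B - interior A"
  let ?M = "?rim \<union> (B - A)"
  have "frontier B \<subseteq> B" by (simp add: closed_jordan_region[OF B] frontier_subset_closed)
  then show "?M \<subseteq> B - interior A" using interior_subset[of A] by blast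
  have "\<not> frontier B \<subseteq> A"
    using jordan_region_subset_if_frontier_subset[OF A B] assms(2) by blast
  then obtain r where r: "r \<in> ?rim" using interior_subset[of A] by blast
  have "connected_component ?M r x" if "x \<in> ?M" for x
  proof (cases "x \<in> ?rim")
    case True
    then show ?thesis
      using r by (intro connected_componentI[OF connected_frontier_Diff_interior[OF assms]]) auto
  next
    case False
    then have "x \<in> B - A" using that by blast
    then obtain K where K: "connected K" "x \<in> K" "K \<subseteq> B - A" "K \<inter> frontier B \<noteq> {}"
      by (rule connected_set_to_frontier[OF A B])
    have "K \<inter> ?rim \<noteq> {}" using K(3,4) interior_subset[of A] by blast
    then have "connected (?rim \<union> K)"
      using connected_Un[OF connected_frontier_Diff_interior[OF assms] K(1)]
      by (simp add: Int_commute)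
    then show ?thesis
      using r K(2,3) by (intro connected_componentI[of "?rim \<union> K"]) auto
  qed
  then show "connected ?M"
    unfolding connected_iff_connected_component
    by (meson connected_component_sym connected_component_trans)
  have "interior B \<inter> closure (- A) \<subseteq> closure (B - A)"
    using open_Int_closure_subset[OF open_interior, of B "- A"] interior_subset[of B]
      closure_mono[of "interior B \<inter> - A" "B - A"] by blast
  also have "\<dots> \<subseteq> closure ?M" by (rule closure_mono) blast
  finally have "interior B - interior A \<subseteq> closure ?M" by (simp add: closure_complement Diff_eq)
  moreover have "B \<subseteq> interior B \<union> frontier B"
    using closure_subset[of B] unfolding frontier_def by blast
  moreover have "?rim \<subseteq> closure ?M" using closure_subset[of ?M] by blast
  ultimately show "B - interior A \<subseteq> closure ?M" by blast
qed

theorem connected_Diff_pseudo_discs: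
  assumes pd: "pseudo_discs {A,B}" and "\<not> B \<subseteq> A"
  shows "connected (A - B)"
proof (rule connected_intermediate_closure)
  have A: "jordan_region A" and B: "jordan_region B"
    using pd by (simp_all add: pseudo_discs_def)
  have "connected (- (B \<union> - interior A))"
  proof (rule Janiszewski_connected)
    show "connected (B \<inter> - interior A)"
      using connected_Diff_interior[OF assms] by (simp add: Diff_eq)
  qed (use A B in \<open>simp_all add: compact_jordan_region connected_Compl_jordan_region
        connected_interior_jordan_region closed_Compl\<close>)
  then show "connected (interior A - B)" by (simp add: Diff_eq Int_commute)
  show "interior A - B \<subseteq> A - B" using interior_subset[of A] by blast
  have "- B \<inter> closure (interior A) \<subseteq> closure (- B \<inter> interior A)"
    using closed_jordan_region[OF B] by (intro open_Int_closure_subset) auto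
  then show "A - B \<subseteq> closure (interior A - B)"
    by (simp add: closure_interior_jordan_region[OF A] Diff_eq Int_commute)
qed

lemma crossing_eq_if_loop_avoids_path:
  assumes "path \<gamma>" "path g" "pathstart g = pathstart \<gamma>" "pathfinish g = pathfinish \<gamma>"
    and h: "path h" "pathstart h = pathstart \<delta>" "pathfinish h = pathfinish \<delta>"
    and avoid: "path_image h \<inter> path_image \<gamma> = {}" "path_image h \<inter> path_image g = {}"
  shows "crossing \<gamma> \<delta> = crossing g \<delta>"
proof -
  let ?\<rho> = "\<gamma> +++ reversepath g"
  have ends: "pathstart \<delta> \<in> path_image h" "pathfinish \<delta> \<in> path_image h"
    using h by (metis pathstart_in_path_image pathfinish_in_path_image)+
  have split: "winding_number ?\<rho> z = winding_number \<gamma> z - winding_number g z"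
    if "z \<in> path_image h" for z
  proof -
    have "z \<notin> path_image \<gamma>" "z \<notin> path_image g" using that avoid by blast+
    then show ?thesis
      using assms(1-4) by (simp add: winding_number_join winding_number_reversepath)
  qed
  have "winding_number ?\<rho> (pathstart \<delta>) = winding_number ?\<rho> (pathfinish \<delta>)"
    using assms(1-4) avoid ends connected_path_image[OF h(1)]
    by (intro winding_number_eq[of _ _ "path_image h"]) (auto simp: path_image_join)
  then show ?thesis
    using split[OF ends(1)] split[OF ends(2)] assms(3,4) by (simp add: crossing_def algebra_simps)
qed

text \<open>The path \<open>\<gamma>\<close> is replaced by a path \<open>g\<close> that avoids \<open>B\<close> and some path \<open>h\<close> joining the end
  points of \<open>\<delta>\<close> outside \<open>A\<close>.\<close>

lemma unlinked_pseudo_discs: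
  assumes pd: "pseudo_discs {A,B}"
    and \<gamma>: "path \<gamma>" "path_image \<gamma> \<subseteq> A" "pathstart \<gamma> \<notin> B" "pathfinish \<gamma> \<notin> B"
    and \<delta>: "path \<delta>" "path_image \<delta> \<subseteq> B" "pathstart \<delta> \<notin> A" "pathfinish \<delta> \<notin> A"
  shows "unlinked \<gamma> \<delta>"
proof -
  have A: "jordan_region A" and B: "jordan_region B"
    using pd by (simp_all add: pseudo_discs_def)
  obtain h where h: "path h" "path_image h \<subseteq> - A" "pathstart h = pathstart \<delta>"
    "pathfinish h = pathfinish \<delta>"
    using path_connected_Compl_jordan_region[OF A] \<delta>(3,4) unfolding path_connected_def
    by (metis ComplI)
  let ?C = "B \<union> path_image h"
  have "connected (A - B)"
    using connected_Diff_pseudo_discs[OF pd] \<delta>(2,3) pathstart_in_path_image by blast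
  then have "connected_component (- ?C) (pathstart \<gamma>) (pathfinish \<gamma>)"
    using \<gamma> h(2) pathstart_in_path_image[of \<gamma>] pathfinish_in_path_image[of \<gamma>]
    by (intro connected_componentI[of "A - B"]) auto
  moreover have "open (- ?C)"
    using closed_jordan_region[OF B] closed_path_image[OF h(1)] by (intro open_Compl closed_Un)
  ultimately obtain g where g: "path g" "path_image g \<subseteq> - ?C" "pathstart g = pathstart \<gamma>"
    "pathfinish g = pathfinish \<gamma>"
    by (metis open_path_connected_component path_component_def)
  have "crossing \<gamma> \<delta> = crossing g \<delta>"
    using g(2) h(2) \<gamma>(2)
    by (intro crossing_eq_if_loop_avoids_path[OF \<gamma>(1) g(1,3,4) h(1,3,4)]) blast+
  also have "\<dots> = 0"
    using crossing_disjoint[OF g(1) \<delta>(1)] g(2) \<delta>(2) by blast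
  finally show ?thesis
    using \<gamma> \<delta> by (auto simp: unlinked_def)
qed

section \<open>Clique minors in dense graphs\<close>

definition connected_in :: "('a \<Rightarrow> 'a \<Rightarrow> bool) \<Rightarrow> 'a set \<Rightarrow> bool" where
  "connected_in E X \<longleftrightarrow> (\<forall>x\<in>X. \<forall>y\<in>X. (x,y) \<in> {(u,v). u \<in> X \<and> v \<in> X \<and> E u v}\<^sup>*)"

definition touching :: "('a \<Rightarrow> 'a \<Rightarrow> bool) \<Rightarrow> 'a set \<Rightarrow> 'a set \<Rightarrow> bool" where
  "touching E X Y \<longleftrightarrow> (\<exists>x\<in>X. \<exists>y\<in>Y. E x y)"

lemma touching_commute: "symp E \<Longrightarrow> touching E X Y \<longleftrightarrow> touching E Y X"
  unfolding touching_def by (meson sympD)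

lemma touching_Un: "touching E (X \<union> Y) Z \<longleftrightarrow> touching E X Z \<or> touching E Y Z"
  unfolding touching_def by blast

lemma connected_in_singleton: "connected_in E {x}"
  by (simp add: connected_in_def)

lemma connected_in_Un:
  assumes "symp E" "connected_in E X" "connected_in E Y" "touching E X Y"
  shows "connected_in E (X \<union> Y)"
proof -
  let ?R = "\<lambda>S. {(u,v). u \<in> S \<and> v \<in> S \<and> E u v}\<^sup>*"
  have mono: "?R X \<subseteq> ?R (X \<union> Y)" "?R Y \<subseteq> ?R (X \<union> Y)" by (intro rtrancl_mono; blast)+
  obtain x y where xy: "x \<in> X" "y \<in> Y" "E x y" using assms(4) unfolding touching_def by blast
  then have crossing: "(x,y) \<in> ?R (X \<union> Y)" "(y,x) \<in> ?R (X \<union> Y)"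
    using assms(1) by (auto intro!: r_into_rtrancl dest: sympD)
  have "(u,x) \<in> ?R (X \<union> Y) \<and> (x,u) \<in> ?R (X \<union> Y)" if "u \<in> X \<union> Y" for u
  proof (cases "u \<in> X")
    case True
    then show ?thesis using assms(2) mono(1) xy(1) unfolding connected_in_def by blast
  next
    case False
    then have "(u,y) \<in> ?R (X \<union> Y)" "(y,u) \<in> ?R (X \<union> Y)"
      using assms(3) mono(2) xy(2) that unfolding connected_in_def by blast+
    then show ?thesis using crossing by (meson rtrancl_trans)
  qed
  then show ?thesis unfolding connected_in_def by (meson rtrancl_trans)
qed

definition branch_sets :: "('a \<Rightarrow> 'a \<Rightarrow> bool) \<Rightarrow> 'a set set \<Rightarrow> bool" where
  "branch_sets E P \<longleftrightarrow> finite P \<and> disjoint P \<and> {} \<notin> P \<and> (\<forall>X\<in>P. connected_in E X)"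

lemma branch_sets_subset: "branch_sets E P \<Longrightarrow> Q \<subseteq> P \<Longrightarrow> branch_sets E Q"
  unfolding branch_sets_def by (meson finite_subset pairwise_subset subsetD)

lemma branch_sets_disjoint: "branch_sets E P \<Longrightarrow> X \<in> P \<Longrightarrow> Y \<in> P \<Longrightarrow> X \<noteq> Y \<Longrightarrow> X \<inter> Y = {}"
  unfolding branch_sets_def disjoint_def by blast

definition neighbours :: "('a \<Rightarrow> 'a \<Rightarrow> bool) \<Rightarrow> 'a set set \<Rightarrow> 'a set \<Rightarrow> 'a set set" where
  "neighbours E P X = {Y \<in> P. Y \<noteq> X \<and> touching E X Y}"

lemma finite_neighbours: "finite P \<Longrightarrow> finite (neighbours E P X)"
  by (simp add: neighbours_def)

definition degree_sum :: "('a \<Rightarrow> 'a \<Rightarrow> bool) \<Rightarrow> 'a set set \<Rightarrow> nat" where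
  "degree_sum E P = (\<Sum>X\<in>P. card (neighbours E P X))"

lemma degree_sum_insert:
  assumes "symp E" "finite Q" "Z \<notin> Q"
  shows "degree_sum E (insert Z Q) = degree_sum E Q + 2 * card (neighbours E Q Z)"
proof -
  have other: "card (neighbours E (insert Z Q) X)
      = card (neighbours E Q X) + (if touching E Z X then 1 else 0)" if "X \<in> Q" for X
  proof -
    have "neighbours E (insert Z Q) X = neighbours E Q X \<union> (if touching E Z X then {Z} else {})"
      using that assms(3) touching_commute[OF assms(1), of Z X] unfolding neighbours_def by auto
    moreover have "finite (neighbours E Q X)" "Z \<notin> neighbours E Q X"
      using assms unfolding neighbours_def by auto
    ultimately show ?thesis by simp
  qed
  have "neighbours E (insert Z Q) Z = neighbours E Q Z"
    unfolding neighbours_def by auto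
  then have "degree_sum E (insert Z Q)
      = card (neighbours E Q Z) + (\<Sum>X\<in>Q. card (neighbours E (insert Z Q) X))"
    using assms unfolding degree_sum_def by simp
  also have "(\<Sum>X\<in>Q. card (neighbours E (insert Z Q) X))
      = degree_sum E Q + (\<Sum>X\<in>Q. if touching E Z X then 1 else 0)"
    unfolding degree_sum_def by (simp add: other sum.distrib)
  also have "(\<Sum>X\<in>Q. if touching E Z X then 1 else 0) = card (neighbours E Q Z)"
  proof -
    have "neighbours E Q Z = {X \<in> Q. touching E Z X}"
      using assms(3) unfolding neighbours_def by auto
    then show ?thesis using assms(2) by (simp add: sum.If_cases Int_def)
  qed
  finally show ?thesis by simp
qed

definition contract :: "'a set \<Rightarrow> 'a set \<Rightarrow> 'a set set \<Rightarrow> 'a set set" where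
  "contract X Y P = insert (X \<union> Y) (P - {X,Y})"

lemma Union_contract: "X \<in> P \<Longrightarrow> Y \<in> P \<Longrightarrow> \<Union>(contract X Y P) = \<Union>P"
  unfolding contract_def by auto

lemma Un_notin_branch_sets:
  assumes "branch_sets E P" "X \<in> P" "Y \<in> P"
  shows "X \<union> Y \<notin> P - {X,Y}"
proof
  assume "X \<union> Y \<in> P - {X,Y}"
  then have "X \<inter> (X \<union> Y) = {}" using assms by (intro branch_sets_disjoint) auto
  then show False using assms unfolding branch_sets_def by auto
qed

lemma card_contract:
  assumes "branch_sets E P" "X \<in> P" "Y \<in> P" "X \<noteq> Y"
  shows "card P = card (contract X Y P) + 1"
proof -
  have "finite P" using assms(1) by (simp add: branch_sets_def)
  then have "card (P - {X,Y}) + 2 = card P"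
    using assms card_mono[of P "{X,Y}"] by (simp add: card_Diff_subset)
  then show ?thesis
    using Un_notin_branch_sets[OF assms(1-3)] \<open>finite P\<close> unfolding contract_def by simp
qed

lemma branch_sets_contract:
  assumes "symp E" "branch_sets E P" "X \<in> P" "Y \<in> P" "touching E X Y"
  shows "branch_sets E (contract X Y P)"
proof -
  have "(X \<union> Y) \<inter> Z = {}" if "Z \<in> P - {X,Y}" for Z
    using that branch_sets_disjoint[OF assms(2)] assms(3,4) by blast
  moreover have "disjoint P" "finite P" "{} \<notin> P" using assms(2) by (simp_all add: branch_sets_def)
  ultimately have "disjoint (contract X Y P)"
    unfolding contract_def disjoint_def by (simp add: Int_commute)
  moreover have "connected_in E Z" if "Z \<in> contract X Y P" for Z
    using that assms connected_in_Un[OF assms(1)] unfolding contract_def branch_sets_def by blast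
  ultimately show ?thesis
    using \<open>finite P\<close> \<open>{} \<notin> P\<close> assms(3) unfolding branch_sets_def contract_def by auto
qed

text \<open>The contraction loses the edge \<open>XY\<close> and merges the two edges to each common neighbour.\<close>

lemma degree_sum_contract:
  assumes "symp E" "branch_sets E P" "X \<in> P" "Y \<in> P" "X \<noteq> Y" "touching E X Y"
  shows "degree_sum E P
    = degree_sum E (contract X Y P) + 2 + 2 * card (neighbours E P X \<inter> neighbours E P Y)"
proof -
  define Q where "Q = P - {X,Y}"
  have fin: "finite Q" and notin: "X \<notin> Q" "Y \<notin> insert X Q" and P: "P = insert Y (insert X Q)"
    using assms unfolding Q_def branch_sets_def by auto
  have UnQ: "X \<union> Y \<notin> Q" using Un_notin_branch_sets[OF assms(2-4)] by (simp add: Q_def)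
  have "neighbours E (insert X Q) Y = insert X (neighbours E Q Y)"
    using assms(5,6) touching_commute[OF assms(1), of X Y] unfolding neighbours_def by auto
  moreover have "X \<notin> neighbours E Q Y" using notin unfolding neighbours_def by simp
  ultimately have "card (neighbours E (insert X Q) Y) = Suc (card (neighbours E Q Y))"
    using finite_neighbours[OF fin] by simp
  then have "degree_sum E P
      = degree_sum E Q + 2 + 2 * (card (neighbours E Q X) + card (neighbours E Q Y))"
    unfolding P using degree_sum_insert[OF assms(1) _ notin(2)]
      degree_sum_insert[OF assms(1) fin notin(1)] fin by simp
  also have "card (neighbours E Q X) + card (neighbours E Q Y)
      = card (neighbours E Q X \<union> neighbours E Q Y) + card (neighbours E Q X \<inter> neighbours E Q Y)"
    by (intro card_Un_Int finite_neighbours fin)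
  also have "neighbours E Q X \<union> neighbours E Q Y = neighbours E Q (X \<union> Y)"
    using UnQ notin unfolding neighbours_def by (auto simp: touching_Un)
  also have "neighbours E Q X \<inter> neighbours E Q Y = neighbours E P X \<inter> neighbours E P Y"
    unfolding neighbours_def Q_def by auto
  finally show ?thesis
    using degree_sum_insert[OF assms(1) fin UnQ] unfolding contract_def Q_def by simp
qed

lemma common_neighbours_if_sparser_contraction:
  assumes "symp E" "branch_sets E P" "X \<in> P" "Y \<in> P" "X \<noteq> Y" "touching E X Y"
    and "2 * k * card P \<le> degree_sum E P"
    and "degree_sum E (contract X Y P) < 2 * k * card (contract X Y P)"
  shows "k \<le> card (neighbours E P X \<inter> neighbours E P Y)"
proof -
  have "2 * k * card P = 2 * k * card (contract X Y P) + 2 * k"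
    using card_contract[OF assms(2-5)] by simp
  then have "2 * k < 2 + 2 * card (neighbours E P X \<inter> neighbours E P Y)"
    using degree_sum_contract[OF assms(1-6)] assms(7,8) by linarith
  then show ?thesis by simp
qed

lemma dense_neighbourhood:
  assumes "symp E" "branch_sets E P" "P \<noteq> {}" "0 < k" "2 * k * card P \<le> degree_sum E P"
    and sparser: "\<And>X Y. X \<in> P \<Longrightarrow> Y \<in> P \<Longrightarrow> X \<noteq> Y \<Longrightarrow> touching E X Y \<Longrightarrow>
      degree_sum E (contract X Y P) < 2 * k * card (contract X Y P)"
  obtains X where "X \<in> P" "neighbours E P X \<noteq> {}"
    "k * card (neighbours E P X) \<le> degree_sum E (neighbours E P X)"
proof -
  have "0 < card P" using assms(2,3) by (simp add: branch_sets_def card_gt_0_iff)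
  then have "0 < 2 * k * card P" using assms(4) by simp
  then have "degree_sum E P \<noteq> 0" using assms(5) by linarith
  then obtain X where X: "X \<in> P" "card (neighbours E P X) \<noteq> 0"
    unfolding degree_sum_def by (metis sum.neutral)
  let ?N = "neighbours E P X"
  have "k \<le> card (neighbours E ?N Y)" if "Y \<in> ?N" for Y
  proof -
    have Y: "Y \<in> P" "X \<noteq> Y" "touching E X Y" using that unfolding neighbours_def by auto
    have "neighbours E ?N Y = ?N \<inter> neighbours E P Y" unfolding neighbours_def by auto
    then show ?thesis
      using common_neighbours_if_sparser_contraction[OF assms(1,2) X(1) Y assms(5)]
        sparser[OF X(1) Y] by simp
  qed
  then have "k * card ?N \<le> degree_sum E ?N"
    using sum_bounded_below[of ?N k "\<lambda>Y. card (neighbours E ?N Y)"]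
    unfolding degree_sum_def by (simp add: mult.commute)
  moreover have "?N \<noteq> {}" using X(2) by auto
  ultimately show ?thesis using that[OF X(1)] by blast
qed

definition clique_minor :: "('a \<Rightarrow> 'a \<Rightarrow> bool) \<Rightarrow> 'a set set \<Rightarrow> nat \<Rightarrow> (nat \<Rightarrow> 'a set) \<Rightarrow> bool" where
  "clique_minor E P h f \<longleftrightarrow>
     (\<forall>i<h. f i \<subseteq> \<Union>P \<and> (\<exists>Y\<in>P. Y \<subseteq> f i) \<and> connected_in E (f i)) \<and>
     (\<forall>i<h. \<forall>j<i. f i \<inter> f j = {} \<and> touching E (f i) (f j))"

lemma clique_minor_of_contract:
  assumes "clique_minor E (contract X Y P) h f" "X \<in> P" "Y \<in> P"
  shows "clique_minor E P h f"
proof -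
  have "\<exists>Z\<in>P. Z \<subseteq> f i" if "\<exists>Z\<in>contract X Y P. Z \<subseteq> f i" for i
    using that assms(2) unfolding contract_def by blast
  then show ?thesis
    using assms unfolding clique_minor_def Union_contract[OF assms(2,3)] by simp
qed

lemma clique_minor_of_neighbours:
  assumes "branch_sets E P" "X \<in> P" and f: "clique_minor E (neighbours E P X) h f"
  shows "clique_minor E P (Suc h) (f(h := X))"
proof -
  let ?N = "neighbours E P X" and ?g = "f(h := X)"
  have f_i: "f i \<subseteq> \<Union>?N" "\<exists>Y\<in>?N. Y \<subseteq> f i" "connected_in E (f i)" if "i < h" for i
    using f that unfolding clique_minor_def by blast+
  have "X \<inter> Y = {}" if "Y \<in> ?N" for Y
    using that assms(1,2) by (intro branch_sets_disjoint) (auto simp: neighbours_def)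
  then have disjoint: "X \<inter> f i = {}" if "i < h" for i using f_i(1)[OF that] by blast
  have touch: "touching E X (f i)" if "i < h" for i
    using f_i(2)[OF that] unfolding neighbours_def touching_def by blast
  show ?thesis
    unfolding clique_minor_def
  proof (intro conjI allI impI)
    fix i assume i: "i < Suc h"
    have "?N \<subseteq> P" unfolding neighbours_def by auto
    then show "?g i \<subseteq> \<Union>P" "\<exists>Y\<in>P. Y \<subseteq> ?g i"
      using f_i(1,2)[of i] assms(2) i by (cases "i = h"; auto; blast)+
    show "connected_in E (?g i)"
      using f_i(3)[of i] assms(1,2) i unfolding branch_sets_def by (cases "i = h") auto
    fix j assume j: "j < i"
    show "?g i \<inter> ?g j = {}" "touching E (?g i) (?g j)"
      using disjoint[of j] touch[of j] f i j unfolding clique_minor_def by (cases "i = h"; auto)+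
  qed
qed

text \<open>Mader's argument: contract edges as long as the density survives; afterwards every edge lies
  in many triangles, so that the neighbourhood of a vertex is dense.\<close>

theorem clique_minor_of_dense:
  assumes "symp E" "branch_sets E P" "P \<noteq> {}" "2 ^ Suc h * card P \<le> degree_sum E P"
  shows "\<exists>f. clique_minor E P (Suc h) f"
  using assms(2-)
proof (induction h arbitrary: P)
  case 0
  then obtain X where "X \<in> P" by blast
  then have "clique_minor E P (Suc 0) (\<lambda>_. X)"
    using 0(1) unfolding clique_minor_def branch_sets_def by auto
  then show ?case by blast
next
  case (Suc h)
  note neighbourhood_minor = Suc.IH
  show ?case
    using Suc.prems
  proof (induction "card P" arbitrary: P rule: less_induct)
    case less
    show ?case
    proof (cases "\<exists>X\<in>P. \<exists>Y\<in>P. X \<noteq> Y \<and> touching E X Y \<and>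
        2 ^ Suc (Suc h) * card (contract X Y P) \<le> degree_sum E (contract X Y P)")
      case True
      then obtain X Y where XY: "X \<in> P" "Y \<in> P" "X \<noteq> Y" "touching E X Y"
        and dense: "2 ^ Suc (Suc h) * card (contract X Y P) \<le> degree_sum E (contract X Y P)"
        by blast
      have "\<exists>f. clique_minor E (contract X Y P) (Suc (Suc h)) f"
        using branch_sets_contract[OF assms(1) less.prems(1) XY(1,2,4)] dense
          card_contract[OF less.prems(1) XY(1-3)]
        by (intro less.hyps) (simp_all add: contract_def)
      then show ?thesis using clique_minor_of_contract XY(1,2) by blast
    next
      case False
      then have sparser: "degree_sum E (contract X Y P) < 2 * 2 ^ Suc h * card (contract X Y P)"
        if "X \<in> P" "Y \<in> P" "X \<noteq> Y" "touching E X Y" for X Y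
        using that by (auto simp: not_le)
      have "2 * 2 ^ Suc h * card P \<le> degree_sum E P" using less.prems(3) by simp
      then obtain X where X: "X \<in> P" "neighbours E P X \<noteq> {}"
        "2 ^ Suc h * card (neighbours E P X) \<le> degree_sum E (neighbours E P X)"
        using dense_neighbourhood[OF assms(1) less.prems(1,2) _ _ sparser] by auto
      have "branch_sets E (neighbours E P X)"
        using less.prems(1) by (rule branch_sets_subset) (auto simp: neighbours_def)
      then obtain f where "clique_minor E (neighbours E P X) (Suc h) f"
        using neighbourhood_minor X(2,3) by blast
      then show ?thesis using clique_minor_of_neighbours[OF less.prems(1) X(1)] by blast
    qed
  qed
qed

section \<open>Degree sums and edge sets\<close>

lemma handshake:
  assumes "finite V" "E \<subseteq> Pow V" "\<And>S. S \<in> E \<Longrightarrow> card S = 2"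
  shows "(\<Sum>v\<in>V. card {S\<in>E. v \<in> S}) = 2 * card E"
proof (rule sum_multicount)
  show "finite E" using assms(1,2) finite_subset by blast
  have "{v \<in> V. v \<in> S} = S" if "S \<in> E" for S using assms(2) that by blast
  then show "\<forall>S\<in>E. card {v \<in> V. v \<in> S} = 2" using assms(3) by simp
qed fact

lemma degree_sum_singletons:
  assumes "finite V" "symp E" "irreflp E"
  shows "degree_sum E ((\<lambda>a. {a}) ` V) = 2 * card {{a,a'} |a a'. a \<in> V \<and> a' \<in> V \<and> E a a'}"
    (is "_ = 2 * card ?D")
proof -
  let ?P = "(\<lambda>a. {a}) ` V"
  have irrefl: "\<not> E a a" for a using assms(3) by (simp add: irreflp_def)
  have "card (neighbours E ?P {a}) = card {S\<in>?D. a \<in> S}" if "a \<in> V" for a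
  proof -
    have nbrs: "neighbours E ?P {a} = (\<lambda>a'. {a'}) ` {a'\<in>V. E a a'}"
      using irrefl unfolding neighbours_def touching_def by auto
    have edges: "{S\<in>?D. a \<in> S} = (\<lambda>a'. {a,a'}) ` {a'\<in>V. E a a'}"
      using that assms(2) by (auto simp: insert_commute dest: sympD)
    have "inj_on (\<lambda>a'. {a,a'}) {a'\<in>V. E a a'}"
      by (auto intro!: inj_onI simp: doubleton_eq_iff)
    then show ?thesis unfolding nbrs edges by (simp add: card_image)
  qed
  then have "degree_sum E ?P = (\<Sum>a\<in>V. card {S\<in>?D. a \<in> S})"
    unfolding degree_sum_def by (simp add: sum.reindex)
  also have "\<dots> = 2 * card ?D"
  proof (rule handshake[OF assms(1)])
    show "card S = 2" if "S \<in> ?D" for S using that irrefl by (auto simp: card_2_iff) metis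
  qed auto
  finally show ?thesis .
qed

section \<open>Routes through two families of pseudo-discs\<close>

definition meeting :: "'a set set \<Rightarrow> 'a set \<Rightarrow> 'a set set" where
  "meeting V b = {a \<in> V. a \<inter> b \<noteq> {}}"

lemma meetingE:
  assumes "a \<in> meeting V b"
  obtains q where "q \<in> a" "q \<in> b"
  using assms unfolding meeting_def by blast

locale two_pseudo_disc_families =
  fixes F1 F2 :: "complex set set"
  assumes F1: "pseudo_discs F1" and F2: "pseudo_discs F2"
begin

definition territory :: "complex set set \<Rightarrow> complex set set \<Rightarrow> complex set set" where
  "territory V X = X \<union> {b \<in> F2. meeting V b \<subseteq> X}"

text \<open>The points at which a route inside the group \<open>X\<close> may pass from one disc to the next.\<close>

definition junctions :: "complex set set \<Rightarrow> complex set set \<Rightarrow> complex set" where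
  "junctions V X = {q. \<exists>a\<in>X. \<exists>b\<in>F2. meeting V b \<subseteq> X \<and> q \<in> a \<inter> b}"

lemma junctionsI:
  "a \<in> X \<Longrightarrow> b \<in> F2 \<Longrightarrow> meeting V b \<subseteq> X \<Longrightarrow> q \<in> a \<Longrightarrow> q \<in> b \<Longrightarrow> q \<in> junctions V X"
  unfolding junctions_def by blast

lemma junctions_mono: "X \<subseteq> Y \<Longrightarrow> junctions V X \<subseteq> junctions V Y"
  unfolding junctions_def by blast

lemma junction_notin_disjoint_territory:
  assumes "q \<in> junctions V X" "X \<inter> Y = {}" "X \<subseteq> V" "Y \<subseteq> V" "D \<in> territory V Y"
  shows "q \<notin> D"
proof
  assume "q \<in> D"
  obtain a b where "a \<in> X" "meeting V b \<subseteq> X" "q \<in> a" "q \<in> b"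
    using assms(1) unfolding junctions_def by blast
  moreover have "c \<in> meeting V d" if "c \<in> V" "q \<in> c" "q \<in> d" for c d
    using that unfolding meeting_def by blast
  ultimately show False
    using assms(2-) \<open>q \<in> D\<close> unfolding territory_def by blast
qed

lemma territories_same_family_or_disjoint:
  assumes "X \<inter> Y = {}" "X \<subseteq> V" "Y \<subseteq> V" "V \<subseteq> F1" "D \<in> territory V X" "D' \<in> territory V Y"
  shows "{D,D'} \<subseteq> F1 \<or> {D,D'} \<subseteq> F2 \<or> D \<inter> D' = {}"
  using assms unfolding territory_def meeting_def by blast

lemma unlinked_in_territories:
  assumes groups: "X \<inter> Y = {}" "X \<subseteq> V" "Y \<subseteq> V" "V \<subseteq> F1"
    and \<gamma>: "D \<in> territory V X" "path \<gamma>" "path_image \<gamma> \<subseteq> D"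
      "pathstart \<gamma> \<in> junctions V X" "pathfinish \<gamma> \<in> junctions V X"
    and \<delta>: "D' \<in> territory V Y" "path \<delta>" "path_image \<delta> \<subseteq> D'"
      "pathstart \<delta> \<in> junctions V Y" "pathfinish \<delta> \<in> junctions V Y"
  shows "unlinked \<gamma> \<delta>"
proof -
  note \<gamma>_off_D' = junction_notin_disjoint_territory[OF _ groups(1-3) \<delta>(1)]
  have "Y \<inter> X = {}" using groups(1) by blast
  note \<delta>_off_D = junction_notin_disjoint_territory[OF _ this groups(3,2) \<gamma>(1)]
  note unlinked_if_pseudo_discs = unlinked_pseudo_discs[OF _ \<gamma>(2,3) \<gamma>_off_D'[OF \<gamma>(4)]
      \<gamma>_off_D'[OF \<gamma>(5)] \<delta>(2,3) \<delta>_off_D[OF \<delta>(4)] \<delta>_off_D[OF \<delta>(5)]]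
  consider "{D,D'} \<subseteq> F1" | "{D,D'} \<subseteq> F2" | "D \<inter> D' = {}"
    using territories_same_family_or_disjoint[OF groups \<gamma>(1) \<delta>(1)] by blast
  then show ?thesis
  proof cases
    case 3
    then have "path_image \<gamma> \<inter> path_image \<delta> = {}" using \<gamma>(3) \<delta>(3) by blast
    then show ?thesis by (rule unlinked_disjoint[OF \<gamma>(2) \<delta>(2)])
  next
    case 1
    then show ?thesis by (rule unlinked_if_pseudo_discs[OF pseudo_discs_subset[OF F1]])
  next
    case 2
    then show ?thesis by (rule unlinked_if_pseudo_discs[OF pseudo_discs_subset[OF F2]])
  qed
qed

inductive route :: "complex set set \<Rightarrow> complex set set \<Rightarrow> (real \<Rightarrow> complex) \<Rightarrow> bool"
  for V X where
  within: "D \<in> territory V X \<Longrightarrow> path \<gamma> \<Longrightarrow> path_image \<gamma> \<subseteq> D \<Longrightarrow> pathstart \<gamma> \<in> junctions V X \<Longrightarrow>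
    pathfinish \<gamma> \<in> junctions V X \<Longrightarrow> route V X \<gamma>"
| join: "route V X \<gamma> \<Longrightarrow> route V X \<gamma>' \<Longrightarrow> pathfinish \<gamma> = pathstart \<gamma>' \<Longrightarrow> route V X (\<gamma> +++ \<gamma>')"

lemma unlinked_routes:
  assumes "route V X \<gamma>" "route V Y \<delta>" and groups: "X \<inter> Y = {}" "X \<subseteq> V" "Y \<subseteq> V" "V \<subseteq> F1"
  shows "unlinked \<gamma> \<delta>"
  using assms(1)
proof (induction rule: route.induct)
  case (join \<gamma> \<gamma>')
  then show ?case by (simp add: unlinked_join)
next
  case (within D \<gamma>)
  note \<gamma> = within
  show ?case
    using assms(2)
  proof (induction rule: route.induct)
    case (within D' \<delta>)
    then show ?case using unlinked_in_territories[OF groups \<gamma>] by blast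
  next
    case (join \<delta> \<delta>')
    then show ?case by (meson unlinked_join unlinked_sym)
  qed
qed

definition linked_by_route :: "complex set set \<Rightarrow> complex set set \<Rightarrow> complex \<Rightarrow> complex \<Rightarrow> bool" where
  "linked_by_route V X p q \<longleftrightarrow> (\<exists>\<gamma>. route V X \<gamma> \<and> pathstart \<gamma> = p \<and> pathfinish \<gamma> = q)"

lemma linked_by_route_trans:
  "linked_by_route V X p q \<Longrightarrow> linked_by_route V X q r \<Longrightarrow> linked_by_route V X p r"
  unfolding linked_by_route_def by (metis route.join pathstart_join pathfinish_join)

lemma linked_by_route_within:
  assumes "D \<in> territory V X" "X \<subseteq> F1" "p \<in> D" "q \<in> D" "p \<in> junctions V X" "q \<in> junctions V X"
  shows "linked_by_route V X p q"
proof -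
  have "D \<in> F1 \<or> D \<in> F2" using assms(1,2) unfolding territory_def by blast
  then have "path_connected D"
    using F1 F2 pseudo_discs_imp_jordan_region path_connected_jordan_region by blast
  then obtain \<gamma> where "path \<gamma>" "path_image \<gamma> \<subseteq> D" "pathstart \<gamma> = p" "pathfinish \<gamma> = q"
    using assms(3,4) unfolding path_connected_def by metis
  then show ?thesis
    using assms route.within unfolding linked_by_route_def by blast
qed

definition adjacent :: "complex set set \<Rightarrow> complex set \<Rightarrow> complex set \<Rightarrow> bool" where
  "adjacent V a a' \<longleftrightarrow> a \<noteq> a' \<and> (\<exists>b\<in>F2. meeting V b = {a,a'})"

lemma symp_adjacent: "symp (adjacent V)"
  unfolding symp_def adjacent_def by (metis insert_commute)

lemma irreflp_adjacent: "irreflp (adjacent V)"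
  unfolding irreflp_def adjacent_def by blast

lemma linked_by_route_rtrancl_adjacent:
  assumes "X \<subseteq> F1" "a \<in> X" "p \<in> a" "p \<in> junctions V X"
    and "(a,a') \<in> {(x,y). x \<in> X \<and> y \<in> X \<and> adjacent V x y}\<^sup>*"
    and "q \<in> a'" "q \<in> junctions V X"
  shows "linked_by_route V X p q"
  using assms(5-7)
proof (induction arbitrary: q rule: rtrancl_induct)
  case base
  then show ?case using linked_by_route_within[of a] assms unfolding territory_def by blast
next
  case (step x y)
  then obtain b where b: "b \<in> F2" "meeting V b = {x,y}" and xy: "x \<in> X" "y \<in> X"
    unfolding adjacent_def by blast
  obtain r s where r: "r \<in> x" "r \<in> b" and s: "s \<in> y" "s \<in> b"
    using meetingE[of x V b] meetingE[of y V b] b(2) by (metis insertCI)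
  have "meeting V b \<subseteq> X" using b(2) xy by simp
  then have J: "r \<in> junctions V X" "s \<in> junctions V X" and "b \<in> territory V X" "y \<in> territory V X"
    using junctionsI[OF _ b(1)] r s xy b(1) unfolding territory_def by blast+
  have "linked_by_route V X p r" using step.IH r(1) J(1) by blast
  moreover have "linked_by_route V X r s"
    using linked_by_route_within[OF \<open>b \<in> territory V X\<close> assms(1)] r s J by blast
  moreover have "linked_by_route V X s q"
    using linked_by_route_within[OF \<open>y \<in> territory V X\<close> assms(1)] s J step.prems by blast
  ultimately show ?case using linked_by_route_trans by blast
qed

lemma no_K5_of_routes:
  fixes X :: "nat \<Rightarrow> complex set set" and P :: "nat \<Rightarrow> complex"
  assumes V: "V \<subseteq> F1" and X: "\<And>i. i < 5 \<Longrightarrow> X i \<subseteq> V"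
    and disjoint: "\<And>i j. i < 5 \<Longrightarrow> j < 5 \<Longrightarrow> i \<noteq> j \<Longrightarrow> X i \<inter> X j = {}"
    and linked: "\<And>i j. i < j \<Longrightarrow> j < 5 \<Longrightarrow> linked_by_route V (X i \<union> X j) (P i) (P j)"
  shows False
proof -
  have "\<forall>i j. \<exists>\<gamma>. i < j \<longrightarrow> j < (5::nat) \<longrightarrow>
      route V (X i \<union> X j) \<gamma> \<and> pathstart \<gamma> = P i \<and> pathfinish \<gamma> = P j"
    using linked unfolding linked_by_route_def by blast
  then obtain p where p: "\<And>i j. i < j \<Longrightarrow> j < 5 \<Longrightarrow>
      route V (X i \<union> X j) (p i j) \<and> pathstart (p i j) = P i \<and> pathfinish (p i j) = P j"
    by metis
  interpret unlinked_drawing 5 P p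
  proof
    show "unlinked (p i j) (p k l)"
      if "i < j" "j < 5" "k < l" "l < 5" "{i,j} \<inter> {k,l} = {}" for i j k l
    proof (rule unlinked_routes)
      show "(X i \<union> X j) \<inter> (X k \<union> X l) = {}"
        using disjoint[of i k] disjoint[of i l] disjoint[of j k] disjoint[of j l] that by auto
      show "route V (X i \<union> X j) (p i j)" "route V (X k \<union> X l) (p k l)" using p that by blast+
      show "X i \<union> X j \<subseteq> V" "X k \<union> X l \<subseteq> V" using X that by auto
    qed (rule V)
  qed (use p in blast)
  show False using order_less_5 by simp
qed

lemma no_five_connected_groups:
  fixes X :: "nat \<Rightarrow> complex set set"
  assumes V: "V \<subseteq> F1" and X: "\<And>i. i < 5 \<Longrightarrow> X i \<subseteq> V"
    and disjoint: "\<And>i j. i < 5 \<Longrightarrow> j < 5 \<Longrightarrow> i \<noteq> j \<Longrightarrow> X i \<inter> X j = {}"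
    and junction: "\<And>i. i < 5 \<Longrightarrow> junctions V (X i) \<noteq> {}"
    and connected: "\<And>i j. i < j \<Longrightarrow> j < 5 \<Longrightarrow> connected_in (adjacent V) (X i \<union> X j)"
  shows False
proof -
  have "\<exists>a q. a \<in> X i \<and> q \<in> a \<and> q \<in> junctions V (X i)" if "i < 5" for i
    using junction[OF that] unfolding junctions_def by blast
  then obtain a P where aP: "\<And>i. i < 5 \<Longrightarrow> a i \<in> X i \<and> P i \<in> a i \<and> P i \<in> junctions V (X i)"
    by metis
  show False
  proof (rule no_K5_of_routes[of V X P])
    fix i j :: nat assume ij: "i < j" "j < 5"
    let ?X = "X i \<union> X j"
    have "(a i, a j) \<in> {(x,y). x \<in> ?X \<and> y \<in> ?X \<and> adjacent V x y}\<^sup>*"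
      using connected[OF ij] aP[of i] aP[of j] ij unfolding connected_in_def by simp
    moreover have "?X \<subseteq> F1" using X[of i] X[of j] V ij by auto
    moreover have "P i \<in> junctions V ?X" "P j \<in> junctions V ?X"
      using aP[of i] aP[of j] ij junctions_mono[of _ ?X V] by auto
    ultimately show "linked_by_route V ?X (P i) (P j)"
      using linked_by_route_rtrancl_adjacent[of ?X "a i" "P i" V "a j" "P j"] aP[of i] aP[of j] ij
      by simp
  qed (use V X disjoint in auto)
qed

lemma junctions_nonempty:
  assumes "b \<in> F2" "meeting V b \<noteq> {}" "meeting V b \<subseteq> X"
  shows "junctions V X \<noteq> {}"
proof -
  obtain a where "a \<in> meeting V b" using assms(2) by blast
  moreover then obtain q where "q \<in> a" "q \<in> b" by (rule meetingE)
  ultimately show ?thesis using junctionsI[of a X b V q] assms(1,3) by blast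
qed

theorem no_shattered_five:
  assumes "V \<subseteq> F1" "card V = 5"
  shows "\<not> Pow V \<subseteq> meeting V ` F2"
proof
  assume shattered: "Pow V \<subseteq> meeting V ` F2"
  have "finite V" using assms(2) card.infinite by fastforce
  then obtain f where f: "bij_betw f {..<5::nat} V"
    using assms(2) by (metis lessThan_atLeast0 ex_bij_betw_nat_finite)
  have fV: "f i \<in> V" if "i < 5" for i using f that by (auto simp: bij_betw_def)
  have f_neq: "f i \<noteq> f j" if "i < 5" "j < 5" "i \<noteq> j" for i j
    using f that by (auto simp: bij_betw_def inj_on_def)
  show False
  proof (rule no_five_connected_groups[of V "\<lambda>i. {f i}"])
    show "junctions V {f i} \<noteq> {}" if "i < 5" for i
    proof -
      have "{f i} \<in> meeting V ` F2" using shattered fV[OF that] by blast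
      then obtain b where "b \<in> F2" "meeting V b = {f i}" by auto
      then show ?thesis using junctions_nonempty[of b V] by simp
    qed
    show "connected_in (adjacent V) ({f i} \<union> {f j})" if "i < j" "j < 5" for i j
    proof -
      have "{f i, f j} \<in> meeting V ` F2" using shattered fV[of i] fV[of j] that by auto
      then have "adjacent V (f i) (f j)" using f_neq[of i j] that unfolding adjacent_def by force
      then show ?thesis
        by (intro connected_in_Un symp_adjacent connected_in_singleton) (simp add: touching_def)
    qed
  qed (use assms(1) fV f_neq in auto)
qed

lemma no_ten_clique_minor:
  assumes V: "V \<subseteq> F1"
  shows "\<not> clique_minor (adjacent V) ((\<lambda>a. {a}) ` V) 10 f"
proof
  let ?E = "adjacent V"
  assume f: "clique_minor ?E ((\<lambda>a. {a}) ` V) 10 f"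
  have f_subset: "f i \<subseteq> V" and f_connected: "connected_in ?E (f i)" if "i < 10" for i
    using f that unfolding clique_minor_def by auto
  have f_disjoint: "f i \<inter> f j = {}" and f_touching: "touching ?E (f i) (f j)"
    if "i < 10" "j < 10" "i \<noteq> j" for i j
    using f that touching_commute[OF symp_adjacent] unfolding clique_minor_def
    by (metis Int_commute nat_neq_iff)+
  define X where "X i = f (2*i) \<union> f (2*i+1)" for i
  have X_connected: "connected_in ?E (X i)" if "i < 5" for i
    using f_connected f_touching[of "2*i" "2*i+1"] that unfolding X_def
    by (intro connected_in_Un symp_adjacent) auto
  show False
  proof (rule no_five_connected_groups[OF V, of X])
    show "X i \<subseteq> V" if "i < 5" for i
      using f_subset[of "2*i"] f_subset[of "2*i+1"] that unfolding X_def by auto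
    show "X i \<inter> X j = {}" if "i < 5" "j < 5" "i \<noteq> j" for i j
    proof -
      have "2*i \<noteq> 2*j+1" "2*i+1 \<noteq> 2*j" by presburger+
      then show ?thesis
        using f_disjoint[of "2*i" "2*j"] f_disjoint[of "2*i" "2*j+1"] f_disjoint[of "2*i+1" "2*j"]
          f_disjoint[of "2*i+1" "2*j+1"] that unfolding X_def by auto
    qed
    show "junctions V (X i) \<noteq> {}" if "i < 5" for i
    proof -
      have "touching ?E (f (2*i)) (f (2*i+1))" by (rule f_touching) (use that in auto)
      then obtain a a' where a: "a \<in> X i" "a' \<in> X i" "adjacent V a a'"
        unfolding touching_def X_def by blast
      then obtain b where "b \<in> F2" "meeting V b = {a,a'}" unfolding adjacent_def by blast
      then show ?thesis using junctions_nonempty[of b V "X i"] a by simp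
    qed
    fix i j :: nat assume ij: "i < j" "j < 5"
    then have "touching ?E (X i) (X j)"
      using f_touching[of "2*i" "2*j"] unfolding X_def touching_def by auto
    then show "connected_in ?E (X i \<union> X j)"
      using X_connected ij by (intro connected_in_Un symp_adjacent) auto
  qed
qed

theorem delaunay_edges_linear:
  assumes V: "finite V" "V \<subseteq> F1"
  shows "card {S \<in> meeting V ` F2. card S = 2} \<le> 512 * card V"
proof (rule ccontr)
  let ?D = "{S \<in> meeting V ` F2. card S = 2}"
  let ?P = "(\<lambda>a. {a}) ` V"
  assume dense: "\<not> card ?D \<le> 512 * card V"
  have "?D = {{a,a'} |a a'. a \<in> V \<and> a' \<in> V \<and> adjacent V a a'}"
  proof (intro equalityI subsetI)
    fix S assume "S \<in> ?D"
    then obtain b a a' where b: "b \<in> F2" "meeting V b = {a,a'}" "S = {a,a'}" "a \<noteq> a'"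
      by (auto simp: card_2_iff)
    then have "a \<in> V" "a' \<in> V" unfolding meeting_def by blast+
    then show "S \<in> {{a,a'} |a a'. a \<in> V \<and> a' \<in> V \<and> adjacent V a a'}"
      using b unfolding adjacent_def by blast
  next
    fix S assume "S \<in> {{a,a'} |a a'. a \<in> V \<and> a' \<in> V \<and> adjacent V a a'}"
    then obtain a a' b where "S = {a,a'}" "a \<noteq> a'" "b \<in> F2" "meeting V b = {a,a'}"
      unfolding adjacent_def by blast
    then show "S \<in> ?D" by (simp add: rev_image_eqI)
  qed
  then have "degree_sum (adjacent V) ?P = 2 * card ?D"
    using degree_sum_singletons[OF V(1) symp_adjacent irreflp_adjacent] by simp
  then have "2 ^ Suc 9 * card ?P \<le> degree_sum (adjacent V) ?P"
    using dense by (simp add: card_image)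
  moreover have "branch_sets (adjacent V) ?P"
    using V(1) by (auto simp: branch_sets_def disjoint_def connected_in_singleton)
  moreover have "?P \<noteq> {}"
  proof
    assume "?P = {}"
    then have "?D = {}" by (auto simp: meeting_def)
    then have "card ?D = 0" by (simp only: card.empty)
    then show False using dense by linarith
  qed
  ultimately obtain f where "clique_minor (adjacent V) ?P (Suc 9) f"
    using clique_minor_of_dense[OF symp_adjacent] by blast
  then show False using no_ten_clique_minor[OF V(2)] by simp
qed

end

section \<open>Shattering\<close>

definition traces :: "'a set set \<Rightarrow> 'a set \<Rightarrow> 'a set set" where
  "traces F R = (\<lambda>e. e \<inter> R) ` F"

definition shatters :: "'a set set \<Rightarrow> 'a set \<Rightarrow> bool" where
  "shatters F S \<longleftrightarrow> Pow S \<subseteq> traces F S"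

text \<open>An infinite shattered set has cardinality \<open>0\<close> here, but all its finite subsets are shattered
  as well.\<close>

definition vc_dim_le :: "'a set set \<Rightarrow> nat \<Rightarrow> bool" where
  "vc_dim_le F d \<longleftrightarrow> (\<forall>S. shatters F S \<longrightarrow> card S \<le> d)"

lemma vc_dim_leD: "vc_dim_le F d \<Longrightarrow> shatters F S \<Longrightarrow> card S \<le> d"
  unfolding vc_dim_le_def by blast

lemma traces_subset_Pow: "traces F R \<subseteq> Pow R"
  unfolding traces_def by auto

lemma finite_traces: "finite R \<Longrightarrow> finite (traces F R)"
  using finite_subset[OF traces_subset_Pow] by simp

lemma traces_mono: "F \<subseteq> G \<Longrightarrow> traces F R \<subseteq> traces G R"
  unfolding traces_def by auto

lemma traces_traces: "S \<subseteq> R \<Longrightarrow> traces (traces F R) S = traces F S"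
  unfolding traces_def image_image by (intro image_cong) auto

lemma traces_eq_self: "F \<subseteq> Pow V \<Longrightarrow> traces F V = F"
  unfolding traces_def by (force simp: Int_absorb2)

lemma shattersE:
  assumes "shatters F S" "T \<subseteq> S"
  obtains e where "e \<in> F" "e \<inter> S = T"
  using assms unfolding shatters_def traces_def by blast

lemma shattersI: "(\<And>T. T \<subseteq> S \<Longrightarrow> \<exists>e\<in>F. e \<inter> S = T) \<Longrightarrow> shatters F S"
  unfolding shatters_def traces_def by blast

lemma shatters_mono: "shatters F S \<Longrightarrow> F \<subseteq> G \<Longrightarrow> shatters G S"
  unfolding shatters_def using traces_mono by blast

lemma shatters_subset:
  assumes "F \<subseteq> Pow X" "shatters F S"
  shows "S \<subseteq> X"
proof -
  obtain e where "e \<in> F" "e \<inter> S = S" by (rule shattersE[OF assms(2) subset_refl])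
  then show ?thesis using assms(1) by blast
qed

lemma finite_shattered: "finite X \<Longrightarrow> F \<subseteq> Pow X \<Longrightarrow> finite {S. shatters F S}"
  by (rule finite_subset[of _ "Pow X"]) (auto dest: shatters_subset)

lemma shatters_antimono:
  assumes "shatters F S" "T \<subseteq> S"
  shows "shatters F T"
proof (rule shattersI)
  fix Q assume Q: "Q \<subseteq> T"
  then have "Q \<subseteq> S" using assms(2) by (rule order_trans)
  with assms(1) obtain e where "e \<in> F" "e \<inter> S = Q" by (rule shattersE)
  then show "\<exists>e\<in>F. e \<inter> T = Q" using assms(2) Q by blast
qed

lemma shatters_of_traces:
  assumes "shatters (traces F R) S"
  shows "shatters F S"
proof -
  have "S \<subseteq> R" using shatters_subset[OF traces_subset_Pow assms] .
  then show ?thesis using assms unfolding shatters_def by (simp add: traces_traces)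
qed

lemma vc_dim_le_subset: "vc_dim_le F d \<Longrightarrow> G \<subseteq> F \<Longrightarrow> vc_dim_le G d"
  unfolding vc_dim_le_def by (meson shatters_mono)

lemma vc_dim_le_traces: "vc_dim_le F d \<Longrightarrow> vc_dim_le (traces F R) d"
  unfolding vc_dim_le_def by (meson shatters_of_traces)

definition paired :: "'a \<Rightarrow> 'a set set \<Rightarrow> 'a set set" where
  "paired x F = {e \<in> F. x \<notin> e \<and> insert x e \<in> F}"

lemma shatters_insert:
  assumes "shatters (paired x F) S"
  shows "shatters F (insert x S)"
proof (rule shattersI)
  fix T assume T: "T \<subseteq> insert x S"
  obtain e where e: "e \<in> paired x F" "e \<inter> S = T \<inter> S" by (rule shattersE[OF assms, of "T \<inter> S"]) auto
  show "\<exists>e\<in>F. e \<inter> insert x S = T"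
  proof (cases "x \<in> T")
    case True
    then show ?thesis
      using e T unfolding paired_def by (intro bexI[of _ "insert x e"]) auto
  next
    case False
    then show ?thesis using e T unfolding paired_def by (intro bexI[of _ e]) auto
  qed
qed

lemma shatters_paired_notin:
  assumes "shatters (paired x F) S"
  shows "x \<notin> S"
  by (rule shattersE[OF assms subset_refl]) (auto simp: paired_def)

lemma card_eq_traces_plus_paired:
  assumes "finite F"
  shows "card F = card (traces F (- {x})) + card (paired x F)"
proof -
  let ?A = "{e\<in>F. x \<notin> e}" and ?B = "{e\<in>F. x \<in> e}"
  let ?B' = "(\<lambda>e. e - {x}) ` ?B"
  have F: "?A \<union> ?B = F" by auto
  have "card (?A \<union> ?B) = card ?A + card ?B"
    using assms by (intro card_Un_disjoint) auto
  then have "card F = card ?A + card ?B" unfolding F .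
  also have "card ?B = card ?B'"
    by (intro card_image[symmetric] inj_onI) blast
  also have "card ?A + card ?B' = card (?A \<union> ?B') + card (?A \<inter> ?B')"
    using assms by (intro card_Un_Int) auto
  also have "?A \<union> ?B' = traces F (- {x})"
  proof -
    have "(\<lambda>e. e - {x}) ` ?A = (\<lambda>e. e) ` ?A" by (intro image_cong) auto
    moreover have "traces F (- {x}) = (\<lambda>e. e - {x}) ` (?A \<union> ?B)"
      unfolding traces_def F by (simp add: Diff_eq)
    ultimately show ?thesis by (simp only: image_Un image_ident)
  qed
  also have "?A \<inter> ?B' = paired x F"
  proof (intro equalityI subsetI)
    fix e assume "e \<in> ?A \<inter> ?B'"
    then obtain e' where "e \<in> F" "x \<notin> e" "e' \<in> F" "x \<in> e'" "e = e' - {x}" by blast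
    then show "e \<in> paired x F" by (simp add: paired_def insert_absorb)
  next
    fix e assume "e \<in> paired x F"
    then show "e \<in> ?A \<inter> ?B'" by (auto simp: paired_def intro: image_eqI[of _ _ "insert x e"])
  qed
  finally show ?thesis .
qed

theorem card_le_card_shattered:
  assumes "finite X" "F \<subseteq> Pow X"
  shows "card F \<le> card {S. shatters F S}"
  using assms
proof (induction X arbitrary: F)
  case empty
  show ?case
  proof (cases "F = {}")
    case False
    then have F: "F = {{}}" using empty by auto
    then have "{} \<in> {S. shatters F S}" by (simp add: shatters_def traces_def)
    moreover have "finite {S. shatters F S}" using empty by (intro finite_shattered[of "{}"]) auto
    ultimately have "card {S. shatters F S} \<noteq> 0" by auto
    then show ?thesis using F by simp
  qed simp
next
  case (insert x X)
  let ?F1 = "traces F (- {x})" and ?F2 = "paired x F"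
  let ?S1 = "{S. shatters ?F1 S}" and ?S2 = "{S. shatters ?F2 S}"
  have sub: "?F1 \<subseteq> Pow X" "?F2 \<subseteq> Pow X"
    using insert.prems unfolding traces_def paired_def by auto
  have finF: "finite F" using insert finite_subset by fastforce
  have fin: "finite ?S1" "finite ?S2" using finite_shattered[OF insert.hyps(1)] sub by auto
  have notin: "x \<notin> S" if "S \<in> ?S1 \<union> ?S2" for S
    using that shatters_subset[OF sub(1), of S] shatters_subset[OF sub(2), of S] insert.hyps(2)
    by auto
  have "inj_on (insert x) ?S2"
    by (rule inj_on_inverseI[of _ "\<lambda>S. S - {x}"]) (simp add: notin)
  have "card F \<le> card ?S1 + card ?S2"
    using insert.IH[OF sub(1)] insert.IH[OF sub(2)] card_eq_traces_plus_paired[OF finF, of x]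
    by simp
  also have "\<dots> = card (?S1 \<union> insert x ` ?S2)"
    using fin notin \<open>inj_on (insert x) ?S2\<close> by (subst card_Un_disjoint) (auto simp: card_image)
  also have "\<dots> \<le> card {S. shatters F S}"
  proof (rule card_mono)
    show "finite {S. shatters F S}" using insert by (intro finite_shattered[of "insert x X"]) auto
    show "?S1 \<union> insert x ` ?S2 \<subseteq> {S. shatters F S}"
      by (auto intro: shatters_of_traces shatters_insert)
  qed
  finally show ?case .
qed

lemma card_subsets_le_power:
  assumes "finite N"
  shows "card {T. T \<subseteq> N \<and> card T \<le> j} \<le> (card N + 1) ^ j"
proof (induction j)
  case 0
  have "{T. T \<subseteq> N \<and> card T \<le> 0} = {{}}"
    using finite_subset[OF _ assms] by (auto simp: card_eq_0_iff)
  then show ?case by simp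
next
  case (Suc j)
  let ?B = "{T. T \<subseteq> N \<and> card T \<le> j}"
  have "{T. T \<subseteq> N \<and> card T \<le> Suc j} \<subseteq> ?B \<union> (\<lambda>(y,T). insert y T) ` (N \<times> ?B)"
  proof
    fix T assume T: "T \<in> {T. T \<subseteq> N \<and> card T \<le> Suc j}"
    show "T \<in> ?B \<union> (\<lambda>(y,T). insert y T) ` (N \<times> ?B)"
    proof (cases "card T \<le> j")
      case False
      then obtain y where y: "y \<in> T" by fastforce
      have "finite T" using T assms finite_subset by auto
      then have "card (T - {y}) \<le> j" using T y by auto
      then show ?thesis using T y by (intro UnI2 image_eqI[of _ _ "(y, T - {y})"]) auto
    qed (use T in auto)
  qed
  then have "card {T. T \<subseteq> N \<and> card T \<le> Suc j} \<le> card (?B \<union> (\<lambda>(y,T). insert y T) ` (N \<times> ?B))"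
    using assms by (intro card_mono) auto
  also have "\<dots> \<le> card ?B + card (N \<times> ?B)"
    using assms by (intro order_trans[OF card_Un_le] add_left_mono card_image_le) auto
  also have "\<dots> = (card N + 1) * card ?B" by (simp add: card_cartesian_product)
  also have "\<dots> \<le> (card N + 1) * (card N + 1) ^ j" using Suc by (intro mult_left_mono) auto
  finally show ?case by simp
qed

theorem card_traces_le:
  assumes "vc_dim_le F d" "finite U"
  shows "card (traces F U) \<le> (card U + 1) ^ d"
proof -
  have "card (traces F U) \<le> card {S. shatters (traces F U) S}"
    by (rule card_le_card_shattered[OF assms(2) traces_subset_Pow])
  also have "\<dots> \<le> card {S. S \<subseteq> U \<and> card S \<le> d}"
    using shatters_subset[OF traces_subset_Pow] vc_dim_leD[OF vc_dim_le_traces[OF assms(1)]]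
      assms(2) by (intro card_mono) auto
  also have "\<dots> \<le> (card U + 1) ^ d" by (rule card_subsets_le_power[OF assms(2)])
  finally show ?thesis .
qed

section \<open>Density of one-inclusion graphs\<close>

lemma sum_Pow_insert:
  fixes g :: "'a set \<Rightarrow> 'b::comm_monoid_add"
  assumes "finite X" "x \<notin> X"
  shows "sum g (Pow (insert x X)) = (\<Sum>Q\<in>Pow X. g Q + g (insert x Q))"
proof -
  have inj: "inj_on (insert x) (Pow X)"
    by (rule inj_on_inverseI[of _ "\<lambda>Q. Q - {x}"]) (use assms(2) in auto)
  have "sum g (Pow (insert x X)) = sum g (Pow X) + sum g (insert x ` Pow X)"
    unfolding Pow_insert using assms by (intro sum.union_disjoint) auto
  also have "sum g (insert x ` Pow X) = (\<Sum>Q\<in>Pow X. g (insert x Q))"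
    using sum.reindex[OF inj] by simp
  finally show ?thesis by (simp add: sum.distrib)
qed

definition support :: "('a set \<Rightarrow> nat) \<Rightarrow> 'a set \<Rightarrow> 'a set set" where
  "support w X = {Q. Q \<subseteq> X \<and> 0 < w Q}"

definition one_inclusion_weight :: "('a set \<Rightarrow> nat) \<Rightarrow> 'a set \<Rightarrow> nat" where
  "one_inclusion_weight w X = (\<Sum>x\<in>X. \<Sum>Q\<in>Pow (X - {x}). min (w Q) (w (insert x Q)))"

definition max_halves :: "'a \<Rightarrow> ('a set \<Rightarrow> nat) \<Rightarrow> 'a set \<Rightarrow> nat" where
  "max_halves x w Q = max (w Q) (w (insert x Q))"

definition min_halves :: "'a \<Rightarrow> ('a set \<Rightarrow> nat) \<Rightarrow> 'a set \<Rightarrow> nat" where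
  "min_halves x w Q = min (w Q) (w (insert x Q))"

lemma vc_dim_le_support_max_halves:
  assumes "x \<notin> X" "vc_dim_le (support w (insert x X)) d"
  shows "vc_dim_le (support (max_halves x w) X) d"
proof (rule vc_dim_le_subset[OF vc_dim_le_traces[OF assms(2)]])
  show "support (max_halves x w) X \<subseteq> traces (support w (insert x X)) (- {x})"
  proof
    fix Q assume Q: "Q \<in> support (max_halves x w) X"
    then have "Q = Q \<inter> - {x}" "Q = insert x Q \<inter> - {x}"
      using assms(1) unfolding support_def by auto
    moreover have "Q \<in> support w (insert x X) \<or> insert x Q \<in> support w (insert x X)"
      using Q unfolding support_def max_halves_def by auto
    ultimately show "Q \<in> traces (support w (insert x X)) (- {x})"
      unfolding traces_def by blast
  qed
qed

lemma Suc_card_le_if_shatters_support_min_halves: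
  assumes "finite X" "x \<notin> X" "vc_dim_le (support w (insert x X)) d"
    and S: "shatters (support (min_halves x w) X) S"
  shows "Suc (card S) \<le> d"
proof -
  have "support (min_halves x w) X \<subseteq> paired x (support w (insert x X))"
    using assms(2) unfolding support_def min_halves_def paired_def by auto
  then have paired: "shatters (paired x (support w (insert x X))) S" by (rule shatters_mono[OF S])
  have "card (insert x S) \<le> d" by (rule vc_dim_leD[OF assms(3) shatters_insert[OF paired]])
  moreover have "S \<subseteq> X" by (rule shatters_subset[OF _ S]) (auto simp: support_def)
  ultimately show ?thesis
    using shatters_paired_notin[OF paired] finite_subset[OF _ assms(1)] by simp
qed

lemma one_inclusion_weight_insert:
  assumes "finite X" "x \<notin> X"
  shows "one_inclusion_weight w (insert x X) \<le> sum (min_halves x w) (Pow X)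
    + (one_inclusion_weight (max_halves x w) X + one_inclusion_weight (min_halves x w) X)"
proof -
  let ?u = "max_halves x w" and ?l = "min_halves x w"
  have direction: "(\<Sum>Q\<in>Pow (insert x X - {y}). min (w Q) (w (insert y Q)))
      \<le> (\<Sum>Q\<in>Pow (X - {y}). min (?u Q) (?u (insert y Q)) + min (?l Q) (?l (insert y Q)))"
    if "y \<in> X" for y
  proof -
    have "insert x X - {y} = insert x (X - {y})" using that assms(2) by auto
    then have "(\<Sum>Q\<in>Pow (insert x X - {y}). min (w Q) (w (insert y Q)))
      = (\<Sum>Q\<in>Pow (X - {y}). min (w Q) (w (insert y Q))
          + min (w (insert x Q)) (w (insert y (insert x Q))))"
      using sum_Pow_insert[of "X - {y}" x] assms by simp
    also have "\<dots>
        \<le> (\<Sum>Q\<in>Pow (X - {y}). min (?u Q) (?u (insert y Q)) + min (?l Q) (?l (insert y Q)))"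
      unfolding max_halves_def min_halves_def insert_commute[of x y] by (intro sum_mono) linarith
    finally show ?thesis .
  qed
  have "one_inclusion_weight w (insert x X)
      = sum ?l (Pow X) + (\<Sum>y\<in>X. \<Sum>Q\<in>Pow (insert x X - {y}). min (w Q) (w (insert y Q)))"
    using assms by (simp add: one_inclusion_weight_def min_halves_def)
  also have "\<dots> \<le> sum ?l (Pow X) + (one_inclusion_weight ?u X + one_inclusion_weight ?l X)"
    unfolding one_inclusion_weight_def sum.distrib[symmetric]
    by (intro add_left_mono sum_mono direction)
  finally show ?thesis .
qed

text \<open>Haussler's bound on the density of the one-inclusion graph, for weighted vertices. In the
  induction the two halves of the cube are replaced by their pointwise maximum and minimum; the
  support of the minimum has smaller Vapnik-Chervonenkis dimension.\<close>

theorem one_inclusion_weight_le: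
  assumes "finite X" "vc_dim_le (support w X) d"
  shows "one_inclusion_weight w X \<le> d * sum w (Pow X)"
  using assms
proof (induction X arbitrary: w d)
  case empty
  then show ?case by (simp add: one_inclusion_weight_def)
next
  case (insert x X)
  note fin = insert.hyps(1) and x = insert.hyps(2)
  let ?u = "max_halves x w" and ?l = "min_halves x w"
  note Suc_card_le = Suc_card_le_if_shatters_support_min_halves[OF fin x insert.prems]
  have "one_inclusion_weight ?u X \<le> d * sum ?u (Pow X)"
    by (intro insert.IH vc_dim_le_support_max_halves[OF x] insert.prems)
  moreover have "one_inclusion_weight ?l X \<le> (d - 1) * sum ?l (Pow X)"
    using Suc_card_le by (intro insert.IH) (force simp: vc_dim_le_def)
  moreover have "sum ?l (Pow X) = 0" if "d = 0"
  proof (rule ccontr)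
    assume "sum ?l (Pow X) \<noteq> 0"
    then obtain Q where "Q \<in> support ?l X" using fin by (auto simp: support_def)
    then have "shatters (support ?l X) {}" by (auto intro!: shattersI)
    then show False using Suc_card_le that by fastforce
  qed
  ultimately have "one_inclusion_weight w (insert x X) \<le> d * (sum ?u (Pow X) + sum ?l (Pow X))"
    using one_inclusion_weight_insert[OF fin x, of w] by (cases d) (auto simp: algebra_simps)
  also have "sum ?u (Pow X) + sum ?l (Pow X) = sum w (Pow (insert x X))"
    unfolding sum_Pow_insert[OF fin x] sum.distrib[symmetric] max_halves_def min_halves_def
    by (intro sum.cong) auto
  finally show ?case .
qed

section \<open>Cliques in hereditarily sparse graphs\<close>

definition edges_in :: "'a set set \<Rightarrow> 'a set \<Rightarrow> 'a set set" where
  "edges_in G R = {S \<in> G. S \<subseteq> R \<and> card S = 2}"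

definition vertex_neighbours :: "'a set set \<Rightarrow> 'a set \<Rightarrow> 'a \<Rightarrow> 'a set" where
  "vertex_neighbours G R v = {u \<in> R. u \<noteq> v \<and> {u,v} \<in> G}"

definition cliques :: "'a set set \<Rightarrow> 'a set \<Rightarrow> nat \<Rightarrow> 'a set set" where
  "cliques G R j = {S. S \<subseteq> R \<and> S \<noteq> {} \<and> card S \<le> j \<and> (\<forall>T\<subseteq>S. card T = 2 \<longrightarrow> T \<in> G)}"

lemma finite_cliques: "finite R \<Longrightarrow> finite (cliques G R j)"
  unfolding cliques_def by simp

lemma exists_low_degree_vertex:
  assumes "finite R" "R \<noteq> {}" "card (edges_in G R) \<le> k * card R"
  shows "\<exists>v\<in>R. card (vertex_neighbours G R v) \<le> 2 * k"
proof (rule ccontr)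
  assume high: "\<not> (\<exists>v\<in>R. card (vertex_neighbours G R v) \<le> 2 * k)"
  have finE: "finite (edges_in G R)"
    by (rule finite_subset[of _ "Pow R"]) (use assms(1) in \<open>auto simp: edges_in_def\<close>)
  have "Suc (2 * k) \<le> card {S\<in>edges_in G R. v \<in> S}" if v: "v \<in> R" for v
  proof -
    have "Suc (2 * k) \<le> card (vertex_neighbours G R v)" using high v by (simp add: not_le Suc_le_eq)
    also have "\<dots> \<le> card {S\<in>edges_in G R. v \<in> S}"
    proof (rule card_inj_on_le)
      show "inj_on (\<lambda>u. {u,v}) (vertex_neighbours G R v)"
        by (rule inj_onI) (metis doubleton_eq_iff)
      show "(\<lambda>u. {u,v}) ` vertex_neighbours G R v \<subseteq> {S\<in>edges_in G R. v \<in> S}"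
        using v unfolding vertex_neighbours_def edges_in_def by auto
    qed (use finE in simp)
    finally show ?thesis .
  qed
  then have "card R * Suc (2 * k) \<le> (\<Sum>v\<in>R. card {S\<in>edges_in G R. v \<in> S})"
    using sum_bounded_below[of R "Suc (2 * k)"] by simp
  also have "\<dots> = 2 * card (edges_in G R)"
    by (rule handshake[OF assms(1)]) (auto simp: edges_in_def)
  also have "\<dots> \<le> card R * (2 * k)" using assms(3) by (simp add: mult.commute)
  finally show False using assms(1,2) by (simp add: card_gt_0_iff)
qed

lemma cliques_subset_delete_vertex:
  assumes "finite R"
  shows "cliques G R (Suc j)
    \<subseteq> cliques G (R - {v}) (Suc j) \<union> insert v ` {T. T \<subseteq> vertex_neighbours G R v \<and> card T \<le> j}"
proof
  fix S assume S: "S \<in> cliques G R (Suc j)"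
  show "S \<in> cliques G (R - {v}) (Suc j) \<union> insert v ` {T. T \<subseteq> vertex_neighbours G R v \<and> card T \<le> j}"
  proof (cases "v \<in> S")
    case False
    then show ?thesis using S unfolding cliques_def by auto
  next
    case True
    have "u \<in> vertex_neighbours G R v" if "u \<in> S - {v}" for u
    proof -
      have "{u,v} \<subseteq> S" "card {u,v} = 2" using that True by auto
      then have "{u,v} \<in> G" using S unfolding cliques_def by blast
      then show ?thesis using that S unfolding vertex_neighbours_def cliques_def by auto
    qed
    moreover have "card (S - {v}) \<le> j"
      using S True finite_subset[OF _ assms] unfolding cliques_def by auto
    ultimately have "S - {v} \<in> {T. T \<subseteq> vertex_neighbours G R v \<and> card T \<le> j}" by blast
    moreover have "S = insert v (S - {v})" using True by blast
    ultimately show ?thesis by blast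
  qed
qed

theorem card_cliques_le:
  assumes "finite R" "\<And>R'. R' \<subseteq> R \<Longrightarrow> card (edges_in G R') \<le> k * card R'"
  shows "card (cliques G R (Suc j)) \<le> card R * (2 * k + 1) ^ j"
  using assms
proof (induction "card R" arbitrary: R rule: less_induct)
  case less
  note fin = less.prems(1)
  show ?case
  proof (cases "R = {}")
    case True
    then have "cliques G R (Suc j) = {}" unfolding cliques_def by auto
    then show ?thesis by simp
  next
    case False
    then obtain v where v: "v \<in> R" "card (vertex_neighbours G R v) \<le> 2 * k"
      using exists_low_degree_vertex[OF fin False less.prems(2)[OF subset_refl]] by auto
    let ?N = "vertex_neighbours G R v"
    let ?Q = "{T. T \<subseteq> ?N \<and> card T \<le> j}"
    have finN: "finite ?N" using fin unfolding vertex_neighbours_def by simp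
    have card_R: "card (R - {v}) + 1 = card R" using card.remove[OF fin v(1)] by simp
    have "card (cliques G R (Suc j)) \<le> card (cliques G (R - {v}) (Suc j) \<union> insert v ` ?Q)"
      using finN finite_cliques[of "R - {v}"] fin
      by (intro card_mono cliques_subset_delete_vertex) auto
    also have "\<dots> \<le> card (cliques G (R - {v}) (Suc j)) + card (insert v ` ?Q)"
      by (rule card_Un_le)
    also have "card (insert v ` ?Q) \<le> card ?Q" using finN by (intro card_image_le) simp
    also have "card ?Q \<le> (2 * k + 1) ^ j"
      using card_subsets_le_power[OF finN, of j] power_mono[of "card ?N + 1" "2 * k + 1" j] v(2)
      by linarith
    also have "card (cliques G (R - {v}) (Suc j)) \<le> card (R - {v}) * (2 * k + 1) ^ j"
    proof (rule less.hyps)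
      show "card (edges_in G R') \<le> k * card R'" if "R' \<subseteq> R - {v}" for R'
        using that by (intro less.prems(2)) blast
    qed (use card_R fin in auto)
    finally show ?thesis unfolding card_R[symmetric] by simp
  qed
qed

section \<open>Random subsets\<close>

text \<open>The expectation of \<open>h R\<close> when \<open>R\<close> arises from \<open>V\<close> by choosing every element independently
  with probability \<open>p\<close>.\<close>

definition expect :: "real \<Rightarrow> 'a set \<Rightarrow> ('a set \<Rightarrow> real) \<Rightarrow> real" where
  "expect p V h = (\<Sum>R\<in>Pow V. p ^ card R * (1 - p) ^ card (V - R) * h R)"

lemma expect_mono:
  assumes "0 \<le> p" "p \<le> 1" "\<And>R. R \<subseteq> V \<Longrightarrow> g R \<le> h R"
  shows "expect p V g \<le> expect p V h"
  unfolding expect_def using assms by (intro sum_mono mult_left_mono) auto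

lemma expect_add: "expect p V (\<lambda>R. g R + h R) = expect p V g + expect p V h"
  by (simp add: expect_def distrib_left sum.distrib)

lemma expect_cmult: "expect p V (\<lambda>R. c * h R) = c * expect p V h"
  by (simp add: expect_def sum_distrib_left mult_ac)

lemma expect_sum: "expect p V (\<lambda>R. \<Sum>i\<in>I. h i R) = (\<Sum>i\<in>I. expect p V (h i))"
  by (simp add: expect_def sum_distrib_left sum.swap[of _ I])

lemma expect_of_bool_Int:
  assumes "finite V" "Q \<subseteq> e" "e \<subseteq> V"
  shows "expect p V (\<lambda>R. of_bool (R \<inter> e = Q)) = p ^ card Q * (1 - p) ^ card (e - Q)"
proof -
  define f where "f i = (if i \<in> e - Q then 0 else p)" for i
  define g where "g i = (if i \<in> Q then 0 else 1 - p)" for i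
  have "prod f R * prod g (V - R)
      = p ^ card R * (1 - p) ^ card (V - R) * of_bool (R \<inter> e = Q)" if R: "R \<subseteq> V" for R
  proof (cases "R \<inter> e = Q")
    case True
    then have "\<And>i. i \<in> R \<Longrightarrow> f i = p" "\<And>i. i \<in> V - R \<Longrightarrow> g i = 1 - p"
      unfolding f_def g_def by auto
    then show ?thesis using True by simp
  next
    case False
    then have "(\<exists>i\<in>R. f i = 0) \<or> (\<exists>i\<in>V - R. g i = 0)"
      using assms(2,3) R unfolding f_def g_def by auto
    then have "prod f R = 0 \<or> prod g (V - R) = 0"
      using assms(1) finite_subset[OF R] by (auto simp: prod_zero_iff)
    then show ?thesis using False by auto
  qed
  then have "expect p V (\<lambda>R. of_bool (R \<inter> e = Q)) = (\<Sum>R\<in>Pow V. prod f R * prod g (V - R))"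
    unfolding expect_def by (intro sum.cong) auto
  also have "\<dots> = (\<Prod>i\<in>V. f i + g i)" using prod_add[OF assms(1), of f g] by simp
  also have "\<dots> = (\<Prod>i\<in>V. (if i \<in> Q then p else 1) * (if i \<in> e - Q then 1 - p else 1))"
    using assms(2) by (intro prod.cong) (auto simp: f_def g_def)
  also have "\<dots> = (\<Prod>i\<in>Q. p) * (\<Prod>i\<in>e - Q. 1 - p)"
    unfolding prod.distrib using assms
    by (intro arg_cong2[where f = times] prod.mono_neutral_cong_right) auto
  finally show ?thesis by simp
qed

lemma expect_const: "finite V \<Longrightarrow> expect p V (\<lambda>_. c) = c"
  using expect_of_bool_Int[of V "{}" "{}" p] expect_cmult[of p V c "\<lambda>_. 1"] by simp

lemma expect_card_Int:
  assumes "finite V" "e \<subseteq> V"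
  shows "expect p V (\<lambda>R. real (card (R \<inter> e))) = p * real (card e)"
proof -
  have "real (card (R \<inter> e)) = (\<Sum>x\<in>e. of_bool (R \<inter> {x} = {x}))" for R
  proof -
    have "R \<inter> e = {x \<in> e. R \<inter> {x} = {x}}" by auto
    then show ?thesis using finite_subset[OF assms(2,1)] by (simp add: Int_def)
  qed
  then have "expect p V (\<lambda>R. real (card (R \<inter> e)))
      = (\<Sum>x\<in>e. expect p V (\<lambda>R. of_bool (R \<inter> {x} = {x})))"
    by (simp only: expect_sum)
  also have "\<dots> = (\<Sum>x\<in>e. p)"
    using assms by (intro sum.cong) (auto simp: expect_of_bool_Int)
  finally show ?thesis by simp
qed

lemma expect_remove_exchange:
  fixes g :: "'a \<Rightarrow> 'a set \<Rightarrow> real"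
  assumes "finite V"
  shows "(1 - p) * expect p V (\<lambda>R. \<Sum>x\<in>R. g x (R - {x})) = p * expect p V (\<lambda>R. \<Sum>x\<in>V - R. g x R)"
proof -
  define w where "w R = p ^ card R * (1 - p) ^ card (V - R)" for R
  have expect: "expect p V h = (\<Sum>R\<in>Pow V. w R * h R)" for h
    by (simp add: expect_def w_def)
  have fin: "finite R" if "R \<in> Pow V" for R using that assms finite_subset by auto
  have "(1 - p) * expect p V (\<lambda>R. \<Sum>x\<in>R. g x (R - {x}))
      = (\<Sum>(R,x)\<in>(SIGMA R:Pow V. R). (1 - p) * w R * g x (R - {x}))"
    unfolding expect using assms fin
    by (subst sum.Sigma[symmetric]) (auto simp: sum_distrib_left mult_ac)
  also have "\<dots> = (\<Sum>(R,x)\<in>(SIGMA R:Pow V. V - R). p * w R * g x R)"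
  proof (rule sum.reindex_bij_witness[of _ "\<lambda>(R,x). (insert x R, x)" "\<lambda>(R,x). (R - {x}, x)"])
    fix a assume "a \<in> (SIGMA R:Pow V. R)"
    then obtain R x where a: "a = (R,x)" "R \<subseteq> V" "x \<in> R" by auto
    have "V - (R - {x}) = insert x (V - R)" using a by auto
    then have "card (V - (R - {x})) = Suc (card (V - R))" using assms a(3) by simp
    moreover have "card R = Suc (card (R - {x}))" using fin a by (intro card.remove) auto
    ultimately have "(1 - p) * w R = p * w (R - {x})" by (simp add: w_def)
    then show "(case case a of (R,x) \<Rightarrow> (R - {x}, x) of (R,x) \<Rightarrow> p * w R * g x R)
        = (case a of (R,x) \<Rightarrow> (1 - p) * w R * g x (R - {x}))"
      by (simp add: a(1))
  qed (auto simp: insert_absorb)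
  also have "\<dots> = p * expect p V (\<lambda>R. \<Sum>x\<in>V - R. g x R)"
    unfolding expect using assms fin
    by (subst sum.Sigma[symmetric]) (auto simp: sum_distrib_left mult_ac)
  finally show ?thesis .
qed

section \<open>Haussler's packing argument\<close>

definition separated :: "real \<Rightarrow> 'a set set \<Rightarrow> bool" where
  "separated \<delta> F \<longleftrightarrow> pairwise (\<lambda>e e'. \<delta> \<le> real (card (sym_diff e e'))) F"

lemma separated_subset: "separated \<delta> F \<Longrightarrow> G \<subseteq> F \<Longrightarrow> separated \<delta> G"
  unfolding separated_def by (rule pairwise_subset)

lemma maximal_separated_subfamily:
  assumes "finite H" "0 < \<delta>"
  obtains F where "F \<subseteq> H" "separated \<delta> F"
    "\<And>e. e \<in> H \<Longrightarrow> \<exists>P\<in>F. real (card (sym_diff e P)) < \<delta>"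
proof -
  let ?S = "{F. F \<subseteq> H \<and> separated \<delta> F}"
  have "finite ?S" using assms(1) by simp
  moreover have "{} \<in> ?S" by (simp add: separated_def)
  then have "?S \<noteq> {}" by (metis empty_iff)
  ultimately obtain F where F: "F \<in> ?S" and max: "\<forall>F'\<in>?S. F \<subseteq> F' \<longrightarrow> F = F'"
    by (rule bexE[OF finite_has_maximal])
  have "\<exists>P\<in>F. real (card (sym_diff e P)) < \<delta>" if e: "e \<in> H" for e
  proof (rule ccontr)
    assume far: "\<not> ?thesis"
    have "e \<notin> F"
    proof
      assume "e \<in> F"
      then have "\<not> real (card (sym_diff e e)) < \<delta>" using far by blast
      then show False using assms(2) by simp
    qed
    moreover have "separated \<delta> (insert e F)"
      using F far by (simp add: separated_def pairwise_insert not_less Un_commute)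
    moreover have "insert e F \<subseteq> H" using F e by simp
    ultimately have "F = insert e F" using max by (simp add: subset_insertI)
    then show False using \<open>e \<notin> F\<close> by blast
  qed
  then show thesis using that[of F] F by simp
qed

lemma sum_card_sym_diff:
  assumes "finite C" "finite W" "\<And>e e'. e \<in> C \<Longrightarrow> e' \<in> C \<Longrightarrow> sym_diff e e' \<subseteq> W"
  shows "(\<Sum>e\<in>C. \<Sum>e'\<in>C. card (sym_diff e e'))
    = 2 * (\<Sum>x\<in>W. card {e\<in>C. x \<in> e} * card {e\<in>C. x \<notin> e})"
proof -
  let ?D = "\<lambda>(e,e'). sym_diff e e'"
  have "(\<Sum>x\<in>W. card {q \<in> C \<times> C. x \<in> ?D q}) = (\<Sum>q\<in>C \<times> C. card (?D q))"
  proof (rule sum_multicount_gen)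
    have "{x \<in> W. x \<in> ?D q} = ?D q" if "q \<in> C \<times> C" for q
      using that assms(3) by (cases q) blast
    then show "\<forall>q\<in>C \<times> C. card {x \<in> W. x \<in> ?D q} = card (?D q)" by simp
  qed (use assms in auto)
  moreover have "card {q \<in> C \<times> C. x \<in> ?D q} = 2 * (card {e\<in>C. x \<in> e} * card {e\<in>C. x \<notin> e})" for x
  proof -
    let ?A = "{e\<in>C. x \<in> e}" and ?B = "{e\<in>C. x \<notin> e}"
    have "{q \<in> C \<times> C. x \<in> ?D q} = ?A \<times> ?B \<union> ?B \<times> ?A" by auto
    moreover have "card (?A \<times> ?B \<union> ?B \<times> ?A) = card (?A \<times> ?B) + card (?B \<times> ?A)"
      using assms(1) by (intro card_Un_disjoint) auto
    ultimately show ?thesis by (simp add: card_cartesian_product)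
  qed
  ultimately show ?thesis
    by (simp add: sum.cartesian_product case_prod_unfold sum_distrib_left)
qed

lemma separated_sum_card_sym_diff:
  assumes "finite C" "separated \<delta> C"
  shows "real (card C) * ((real (card C) - 1) * \<delta>) \<le> (\<Sum>e\<in>C. \<Sum>e'\<in>C. real (card (sym_diff e e')))"
proof -
  have "(real (card C) - 1) * \<delta> \<le> (\<Sum>e'\<in>C. real (card (sym_diff e e')))" if e: "e \<in> C" for e
  proof -
    have "real (card (C - {e})) = real (card C) - 1"
      using card.remove[OF assms(1) e] by simp
    moreover have "real (card (C - {e})) * \<delta> \<le> (\<Sum>e'\<in>C - {e}. real (card (sym_diff e e')))"
      using assms(2) e unfolding separated_def by (intro sum_bounded_below) (auto dest: pairwiseD)
    moreover have "\<dots> \<le> (\<Sum>e'\<in>C. real (card (sym_diff e e')))"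
      using assms(1) by (intro sum_mono2) auto
    ultimately show ?thesis by simp
  qed
  then show ?thesis by (intro sum_bounded_below)
qed

lemma separated_split_bound:
  assumes fin: "finite C" "finite W" and "C \<noteq> {}" and "separated \<delta> C"
    and W: "\<And>e e'. e \<in> C \<Longrightarrow> e' \<in> C \<Longrightarrow> sym_diff e e' \<subseteq> W"
  shows "\<delta> / 2 * (real (card C) - 1)
    \<le> (\<Sum>x\<in>W. real (min (card {e\<in>C. x \<notin> e}) (card {e\<in>C. x \<in> e})))" (is "_ \<le> ?m")
proof -
  let ?b = "real (card C)"
  have b: "?b > 0" using assms(1,3) by (simp add: card_gt_0_iff)
  have product: "card {e\<in>C. x \<in> e} * card {e\<in>C. x \<notin> e}
      \<le> card C * min (card {e\<in>C. x \<notin> e}) (card {e\<in>C. x \<in> e})" for x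
  proof -
    let ?l = "card {e\<in>C. x \<in> e}" and ?r = "card {e\<in>C. x \<notin> e}"
    have "?l \<le> card C" "?r \<le> card C" using fin by (auto intro: card_mono)
    then have "max ?l ?r * min ?r ?l \<le> card C * min ?r ?l" by (intro mult_right_mono) auto
    moreover have "?l * ?r = max ?l ?r * min ?r ?l" by (simp add: max_def min_def)
    ultimately show ?thesis by simp
  qed
  have "?b * ((?b - 1) * \<delta>) \<le> (\<Sum>e\<in>C. \<Sum>e'\<in>C. real (card (sym_diff e e')))"
    by (rule separated_sum_card_sym_diff[OF assms(1,4)])
  also have "\<dots> = real (\<Sum>e\<in>C. \<Sum>e'\<in>C. card (sym_diff e e'))" by simp
  also have "\<dots> = real (2 * (\<Sum>x\<in>W. card {e\<in>C. x \<in> e} * card {e\<in>C. x \<notin> e}))"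
    by (simp only: sum_card_sym_diff[OF fin W])
  also have "\<dots> \<le> real (2 * (\<Sum>x\<in>W. card C * min (card {e\<in>C. x \<notin> e}) (card {e\<in>C. x \<in> e})))"
    unfolding of_nat_le_iff by (intro mult_left_mono sum_mono product) simp
  also have "\<dots> = ?b * (2 * ?m)" by (simp add: sum_distrib_left mult.left_commute)
  finally have "(?b - 1) * \<delta> \<le> 2 * ?m" using b by (simp only: mult_le_cancel_left_pos)
  then show ?thesis by (simp add: mult.commute)
qed

definition trace_count :: "'a set set \<Rightarrow> 'a set \<Rightarrow> 'a set \<Rightarrow> nat" where
  "trace_count F R Q = card {e \<in> F. e \<inter> R = Q}"

text \<open>The number of pairs of hyperedges in the same trace class on \<open>R\<close> that \<open>x\<close> can separate,
  every hyperedge being used at most once.\<close>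

definition split_weight :: "'a set set \<Rightarrow> 'a set \<Rightarrow> 'a \<Rightarrow> nat" where
  "split_weight F R x
    = (\<Sum>Q\<in>Pow R. min (trace_count F (insert x R) Q) (trace_count F (insert x R) (insert x Q)))"

lemma sum_trace_count:
  assumes "finite F"
  shows "(\<Sum>Q\<in>traces F R. trace_count F R Q) = card F"
  using sum.image_gen[OF assms, of "\<lambda>_. 1::nat" "\<lambda>e. e \<inter> R"]
  unfolding trace_count_def traces_def by simp

lemma sum_split_weight_remove_le:
  fixes F :: "'a set set"
  assumes "finite R" "finite F" "vc_dim_le F d"
  shows "(\<Sum>x\<in>R. split_weight F (R - {x}) x) \<le> d * card F"
proof -
  have "(\<Sum>x\<in>R. split_weight F (R - {x}) x) = one_inclusion_weight (trace_count F R) R"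
    unfolding split_weight_def one_inclusion_weight_def by (simp add: insert_absorb)
  also have "\<dots> \<le> d * sum (trace_count F R) (Pow R)"
  proof (rule one_inclusion_weight_le[OF assms(1)])
    have "support (trace_count F R) R \<subseteq> traces F R"
      unfolding support_def trace_count_def traces_def by (auto simp: card_gt_0_iff)
    then show "vc_dim_le (support (trace_count F R) R) d"
      by (rule vc_dim_le_subset[OF vc_dim_le_traces[OF assms(3)]])
  qed
  also have "sum (trace_count F R) (Pow R) = sum (trace_count F R) (traces F R)"
  proof (rule sum.mono_neutral_right)
    have "trace_count F R Q = card ({} :: 'a set set)" if "Q \<notin> traces F R" for Q
      using that unfolding trace_count_def traces_def by (intro arg_cong[where f = card]) auto
    then show "\<forall>Q\<in>Pow R - traces F R. trace_count F R Q = 0" by simp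
  qed (use assms(1) traces_subset_Pow in auto)
  finally show ?thesis unfolding sum_trace_count[OF assms(2)] .
qed

lemma separated_le_sum_split_weight:
  assumes V: "finite V" "F \<subseteq> Pow V" "R \<subseteq> V" and sep: "separated \<delta> F"
  shows "\<delta> / 2 * (real (card F) - real (card (traces F R))) \<le> (\<Sum>x\<in>V - R. real (split_weight F R x))"
proof -
  let ?m = "\<lambda>x Q. min (trace_count F (insert x R) Q) (trace_count F (insert x R) (insert x Q))"
  have fin: "finite F" "finite R" using V finite_subset[of _ "Pow V"] finite_subset[of R V] by auto
  have class_split: "\<delta> / 2 * (real (trace_count F R Q) - 1) \<le> (\<Sum>x\<in>V - R. real (?m x Q))"
    if Q: "Q \<in> traces F R" for Q
  proof -
    let ?C = "{e\<in>F. e \<inter> R = Q}"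
    have "\<delta> / 2 * (real (card ?C) - 1)
        \<le> (\<Sum>x\<in>V - R. real (min (card {e\<in>?C. x \<notin> e}) (card {e\<in>?C. x \<in> e})))"
    proof (rule separated_split_bound)
      show "?C \<noteq> {}" using Q unfolding traces_def by auto
      show "separated \<delta> ?C" by (rule separated_subset[OF sep]) auto
      show "sym_diff e e' \<subseteq> V - R" if "e \<in> ?C" "e' \<in> ?C" for e e'
        using that V(2) by blast
    qed (use fin V in auto)
    also have "\<dots> = (\<Sum>x\<in>V - R. real (?m x Q))"
    proof (rule sum.cong)
      fix x assume x: "x \<in> V - R"
      have "Q \<subseteq> R" using Q traces_subset_Pow by blast
      then have "{e\<in>?C. x \<notin> e} = {e\<in>F. e \<inter> insert x R = Q}"
        "{e\<in>?C. x \<in> e} = {e\<in>F. e \<inter> insert x R = insert x Q}"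
        using x by auto
      then show "real (min (card {e\<in>?C. x \<notin> e}) (card {e\<in>?C. x \<in> e})) = real (?m x Q)"
        unfolding trace_count_def by simp
    qed simp
    finally show ?thesis by (simp add: trace_count_def)
  qed
  have "real (card F) - real (card (traces F R)) = (\<Sum>Q\<in>traces F R. real (trace_count F R Q) - 1)"
    unfolding sum_trace_count[OF fin(1), of R, symmetric] sum_subtractf by simp
  then have "\<delta> / 2 * (real (card F) - real (card (traces F R)))
      = (\<Sum>Q\<in>traces F R. \<delta> / 2 * (real (trace_count F R Q) - 1))"
    by (simp only: sum_distrib_left)
  also have "\<dots> \<le> (\<Sum>Q\<in>traces F R. \<Sum>x\<in>V - R. real (?m x Q))" by (intro sum_mono class_split)
  also have "\<dots> \<le> (\<Sum>Q\<in>Pow R. \<Sum>x\<in>V - R. real (?m x Q))"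
    using fin(2) traces_subset_Pow by (intro sum_mono2) (auto intro!: sum_nonneg)
  also have "\<dots> = (\<Sum>x\<in>V - R. real (split_weight F R x))"
    unfolding split_weight_def of_nat_sum by (rule sum.swap)
  finally show ?thesis .
qed

theorem haussler_packing:
  assumes V: "finite V" "F \<subseteq> Pow V" and vc: "vc_dim_le F d" and sep: "separated \<delta> F"
    and p: "0 \<le> p" "p \<le> 1"
  shows "p * \<delta> / 2 * (real (card F) - expect p V (\<lambda>R. real (card (traces F R))))
    \<le> real d * real (card F)"
proof -
  let ?E = "expect p V"
  have fin: "finite F" using V finite_subset[of _ "Pow V"] by simp
  have "\<delta> / 2 * (real (card F) - ?E (\<lambda>R. real (card (traces F R))))
      = ?E (\<lambda>R. \<delta> / 2 * (real (card F) + (- 1) * real (card (traces F R))))"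
    unfolding expect_cmult expect_add expect_const[OF V(1)] by simp
  also have "\<dots> \<le> ?E (\<lambda>R. \<Sum>x\<in>V - R. real (split_weight F R x))"
    using separated_le_sum_split_weight[OF V _ sep] by (intro expect_mono p) simp
  finally have "p * (\<delta> / 2 * (real (card F) - ?E (\<lambda>R. real (card (traces F R)))))
      \<le> p * ?E (\<lambda>R. \<Sum>x\<in>V - R. real (split_weight F R x))"
    using p(1) by (rule mult_left_mono)
  also have "\<dots> = (1 - p) * ?E (\<lambda>R. \<Sum>x\<in>R. real (split_weight F (R - {x}) x))"
    using expect_remove_exchange[OF V(1), of p "\<lambda>x R. real (split_weight F R x)"] by simp
  also have "\<dots> \<le> (1 - p) * ?E (\<lambda>R. real (d * card F))"
  proof (intro mult_left_mono expect_mono p)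
    show "(\<Sum>x\<in>R. real (split_weight F (R - {x}) x)) \<le> real (d * card F)" if "R \<subseteq> V" for R
      using sum_split_weight_remove_le[OF finite_subset[OF that V(1)] fin vc]
      unfolding of_nat_sum[symmetric] of_nat_le_iff .
  qed (use p in simp)
  also have "\<dots> \<le> real d * real (card F)"
    using p by (simp add: expect_const[OF V(1)] mult_left_le_one_le)
  finally show ?thesis by simp
qed

section \<open>Nets by double sampling\<close>

definition samples :: "'a set \<Rightarrow> nat \<Rightarrow> (nat \<Rightarrow> 'a) set" where
  "samples X s = PiE {..<s} (\<lambda>_. X)"

lemma finite_samples: "finite X \<Longrightarrow> finite (samples X s)"
  by (simp add: samples_def finite_PiE)

lemma sample_in: "f \<in> samples X s \<Longrightarrow> j < s \<Longrightarrow> f j \<in> X"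
  unfolding samples_def by auto

lemma card_samples_hitting:
  assumes "g \<subseteq> X" "j < s"
  shows "card X * card {f \<in> samples X s. f j \<in> g} = card g * card (samples X s)"
proof -
  have "{f \<in> samples X s. f j \<in> g} = PiE {..<s} (\<lambda>i. if i = j then g else X)"
    using assms unfolding samples_def by (auto simp: PiE_def Pi_def split: if_splits)
  then have "card {f \<in> samples X s. f j \<in> g} = (\<Prod>i<s. card (if i = j then g else X))"
    by (simp add: card_PiE)
  also have "\<dots> = card g * (\<Prod>i\<in>{..<s} - {j}. card X)"
    using assms(2) by (subst prod.remove[of _ j]) auto
  finally have "card X * card {f \<in> samples X s. f j \<in> g}
      = card g * (card X * (\<Prod>i\<in>{..<s} - {j}. card X))"
    by (simp only: mult.left_commute)
  also have "card X * (\<Prod>i\<in>{..<s} - {j}. card X) = (\<Prod>i<s. card X)"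
    using assms(2) by (intro prod.remove[symmetric]) auto
  finally show ?thesis by (simp add: samples_def card_PiE)
qed

definition hits :: "(nat \<Rightarrow> 'a) \<Rightarrow> nat \<Rightarrow> 'a set \<Rightarrow> nat" where
  "hits f s g = card {j\<in>{..<s}. f j \<in> g}"

lemma markov_samples:
  assumes "finite X" "X \<noteq> {}" "g \<subseteq> X" "4 * card g \<le> card X"
  shows "card (samples X (2*r)) \<le> 2 * card {f \<in> samples X (2*r). hits f (2*r) g \<le> r}"
proof -
  let ?\<Omega> = "samples X (2*r)"
  let ?good = "{f\<in>?\<Omega>. hits f (2*r) g \<le> r}" and ?bad = "{f\<in>?\<Omega>. \<not> hits f (2*r) g \<le> r}"
  have fin: "finite ?\<Omega>" by (rule finite_samples[OF assms(1)])
  have rarely: "4 * card {f\<in>?\<Omega>. f j \<in> g} \<le> card ?\<Omega>" if "j < 2*r" for j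
  proof -
    have "card X * (4 * card {f\<in>?\<Omega>. f j \<in> g}) = 4 * card g * card ?\<Omega>"
      using card_samples_hitting[OF assms(3) that] by simp
    also have "\<dots> \<le> card X * card ?\<Omega>" using assms(4) by (rule mult_le_mono1)
    finally show ?thesis using assms(1,2) by (simp add: card_gt_0_iff)
  qed
  have "(\<Sum>f\<in>?\<Omega>. hits f (2*r) g) = (\<Sum>j<2*r. card {f\<in>?\<Omega>. f j \<in> g})"
    unfolding hits_def by (rule sum_multicount_gen) (use fin in auto)
  then have "4 * (\<Sum>f\<in>?\<Omega>. hits f (2*r) g) = (\<Sum>j<2*r. 4 * card {f\<in>?\<Omega>. f j \<in> g})"
    by (simp only: sum_distrib_left)
  also have "\<dots> \<le> (\<Sum>j<2*r. card ?\<Omega>)" using rarely by (intro sum_mono) simp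
  finally have total: "2 * (\<Sum>f\<in>?\<Omega>. hits f (2*r) g) \<le> r * card ?\<Omega>" by simp
  have "(r + 1) * card ?bad \<le> (\<Sum>f\<in>?bad. hits f (2*r) g)"
    using sum_bounded_below[of ?bad "r + 1" "\<lambda>f. hits f (2*r) g"] by (simp add: mult.commute)
  also have "\<dots> \<le> (\<Sum>f\<in>?\<Omega>. hits f (2*r) g)" using fin by (intro sum_mono2) auto
  finally have "(r + 1) * (2 * card ?bad) \<le> r * card ?\<Omega>" using total by linarith
  also have "\<dots> \<le> (r + 1) * card ?\<Omega>" by simp
  finally have "2 * card ?bad \<le> card ?\<Omega>" by (simp only: mult_le_cancel1)
  moreover have "card ?\<Omega> = card ?good + card ?bad"
  proof -
    have "?good \<union> ?bad = ?\<Omega>" by auto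
    moreover have "card (?good \<union> ?bad) = card ?good + card ?bad"
      using fin by (intro card_Un_disjoint) auto
    ultimately show ?thesis by (simp only:)
  qed
  ultimately show ?thesis by linarith
qed

definition fooled :: "nat \<Rightarrow> 'a set \<Rightarrow> (nat \<Rightarrow> 'a) \<times> (nat \<Rightarrow> 'a) \<Rightarrow> bool" where
  "fooled r g z \<longleftrightarrow> (\<forall>j<2*r. fst z j \<in> g) \<and> hits (snd z) (2*r) g \<le> r"

definition fooled_pairs :: "nat \<Rightarrow> 'a set \<Rightarrow> 'a set set \<Rightarrow> ((nat \<Rightarrow> 'a) \<times> (nat \<Rightarrow> 'a)) set" where
  "fooled_pairs r X G = {z \<in> samples X (2*r) \<times> samples X (2*r). \<exists>g\<in>G. fooled r g z}"

lemma many_fooled_pairs: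
  assumes "finite X" "X \<noteq> {}" and G: "\<And>g. g \<in> G \<Longrightarrow> g \<subseteq> X \<and> 4 * card g \<le> card X"
    and covered: "\<And>f. f \<in> samples X (2*r) \<Longrightarrow> \<exists>g\<in>G. \<forall>j<2*r. f j \<in> g"
  shows "card (samples X (2*r)) * card (samples X (2*r)) \<le> 2 * card (fooled_pairs r X G)"
proof -
  let ?\<Omega> = "samples X (2*r)" and ?B = "fooled_pairs r X G"
  have fin: "finite ?\<Omega>" by (rule finite_samples[OF assms(1)])
  have "card ?\<Omega> \<le> 2 * card {f'\<in>?\<Omega>. (f,f') \<in> ?B}" if f: "f \<in> ?\<Omega>" for f
  proof -
    obtain g where g: "g \<in> G" "\<forall>j<2*r. f j \<in> g" using covered[OF f] by blast
    then have "{f'\<in>?\<Omega>. hits f' (2*r) g \<le> r} \<subseteq> {f'\<in>?\<Omega>. (f,f') \<in> ?B}"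
      using f unfolding fooled_pairs_def fooled_def by auto
    then have "card {f'\<in>?\<Omega>. hits f' (2*r) g \<le> r} \<le> card {f'\<in>?\<Omega>. (f,f') \<in> ?B}"
      using fin by (intro card_mono) auto
    then show ?thesis using markov_samples[OF assms(1,2), of g r] G[OF g(1)] by linarith
  qed
  then have "card ?\<Omega> * card ?\<Omega> \<le> (\<Sum>f\<in>?\<Omega>. 2 * card {f'\<in>?\<Omega>. (f,f') \<in> ?B})"
    using sum_bounded_below[of ?\<Omega> "card ?\<Omega>"] by simp
  also have "\<dots> = 2 * card (SIGMA f:?\<Omega>. {f'\<in>?\<Omega>. (f,f') \<in> ?B})"
    using fin by (simp add: sum_distrib_left)
  also have "(SIGMA f:?\<Omega>. {f'\<in>?\<Omega>. (f,f') \<in> ?B}) = ?B" unfolding fooled_pairs_def by auto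
  finally show ?thesis .
qed

definition swap_on :: "'i set \<Rightarrow> ('i \<Rightarrow> 'a) \<times> ('i \<Rightarrow> 'a) \<Rightarrow> ('i \<Rightarrow> 'a) \<times> ('i \<Rightarrow> 'a)" where
  "swap_on \<sigma> z =
     ((\<lambda>j. if j \<in> \<sigma> then snd z j else fst z j), (\<lambda>j. if j \<in> \<sigma> then fst z j else snd z j))"

lemma swap_on_swap_on: "swap_on \<sigma> (swap_on \<sigma> z) = z"
  by (simp add: swap_on_def fun_eq_iff prod_eq_iff)

lemma swap_on_samples:
  "\<sigma> \<subseteq> {..<s} \<Longrightarrow> z \<in> samples X s \<times> samples X s \<Longrightarrow> swap_on \<sigma> z \<in> samples X s \<times> samples X s"
  unfolding swap_on_def samples_def by (auto simp: PiE_def Pi_def extensional_def)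

text \<open>An index at which only one entry of the pair lies in \<open>h\<close> leaves no choice; at most \<open>r\<close> indices
  have both entries in \<open>h\<close>.\<close>

lemma card_fooled_swaps_le:
  "card {\<sigma>. \<sigma> \<subseteq> {..<2*r} \<and> fooled r h (swap_on \<sigma> z)} \<le> 2 ^ r" (is "card ?A \<le> _")
proof (cases "?A = {}")
  case False
  define J where "J = {j\<in>{..<2*r}. fst z j \<in> h \<and> snd z j \<in> h}"
  have finJ: "finite J" unfolding J_def by simp
  from False obtain \<sigma> where \<sigma>: "fooled r h (swap_on \<sigma> z)" by blast
  have "J \<subseteq> {j\<in>{..<2*r}. snd (swap_on \<sigma> z) j \<in> h}"
    unfolding J_def swap_on_def by auto
  then have "card J \<le> hits (snd (swap_on \<sigma> z)) (2*r) h"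
    unfolding hits_def by (intro card_mono) auto
  then have card_J: "card J \<le> r" using \<sigma> unfolding fooled_def by simp
  have determined: "j \<in> \<sigma> \<longleftrightarrow> j < 2*r \<and> snd z j \<in> h" if "\<sigma> \<in> ?A" "j \<notin> J" for \<sigma> j
  proof -
    have "j \<in> \<sigma> \<Longrightarrow> j < 2*r" and "j < 2*r \<Longrightarrow> (if j \<in> \<sigma> then snd z j else fst z j) \<in> h"
      using that(1) unfolding fooled_def swap_on_def by auto
    then show ?thesis using that(2) unfolding J_def by (auto split: if_splits)
  qed
  have "inj_on (\<lambda>\<sigma>. \<sigma> \<inter> J) ?A"
  proof (intro inj_onI set_eqI)
    fix \<sigma> \<tau> j assume st: "\<sigma> \<in> ?A" "\<tau> \<in> ?A" and same: "\<sigma> \<inter> J = \<tau> \<inter> J"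
    show "j \<in> \<sigma> \<longleftrightarrow> j \<in> \<tau>"
    proof (cases "j \<in> J")
      case True
      then show ?thesis using same by blast
    next
      case False
      then show ?thesis using determined[OF st(1)] determined[OF st(2)] by simp
    qed
  qed
  then have "card ?A \<le> card (Pow J)" using finJ by (intro card_inj_on_le[of "\<lambda>\<sigma>. \<sigma> \<inter> J"]) auto
  also have "\<dots> \<le> 2 ^ r" using finJ card_J by (simp add: card_Pow)
  finally show ?thesis .
next
  case True
  show ?thesis unfolding True by simp
qed

lemma card_swaps_into_fooled_pairs_le:
  assumes "finite X" "z \<in> samples X (2*r) \<times> samples X (2*r)"
    and traces: "\<And>U. U \<subseteq> X \<Longrightarrow> card U \<le> 4 * r \<Longrightarrow> card (traces G U) \<le> N"
  shows "card {\<sigma>\<in>Pow {..<2*r}. swap_on \<sigma> z \<in> fooled_pairs r X G} \<le> N * 2 ^ r"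
proof -
  define U where "U = fst z ` {..<2*r} \<union> snd z ` {..<2*r}"
  have U: "U \<subseteq> X" using assms(2) by (auto simp: U_def mem_Times_iff intro: sample_in)
  have "card U \<le> card {..<2*r} + card {..<2*r}"
    unfolding U_def by (intro order_trans[OF card_Un_le] add_mono card_image_le) auto
  then have "card (traces G U) \<le> N" using traces[OF U] by simp
  let ?A = "\<lambda>h. {\<sigma>. \<sigma> \<subseteq> {..<2*r} \<and> fooled r h (swap_on \<sigma> z)}"
  have finU: "finite (traces G U)" by (rule finite_traces[OF finite_subset[OF U assms(1)]])
  have "fooled r g (swap_on \<sigma> z) \<longleftrightarrow> fooled r (g \<inter> U) (swap_on \<sigma> z)" for \<sigma> g
  proof -
    have "fst (swap_on \<sigma> z) j \<in> U" "snd (swap_on \<sigma> z) j \<in> U" if "j < 2*r" for j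
      using that unfolding U_def swap_on_def by auto
    then show ?thesis unfolding fooled_def hits_def by (auto cong: conj_cong)
  qed
  then have "{\<sigma>\<in>Pow {..<2*r}. swap_on \<sigma> z \<in> fooled_pairs r X G} \<subseteq> (\<Union>h\<in>traces G U. ?A h)"
    unfolding fooled_pairs_def traces_def by auto
  then have "card {\<sigma>\<in>Pow {..<2*r}. swap_on \<sigma> z \<in> fooled_pairs r X G} \<le> card (\<Union>h\<in>traces G U. ?A h)"
    using finU by (intro card_mono) auto
  also have "\<dots> \<le> (\<Sum>h\<in>traces G U. card (?A h))" by (rule card_UN_le[OF finU])
  also have "\<dots> \<le> card (traces G U) * 2 ^ r"
    using sum_bounded_above[of "traces G U" "\<lambda>h. card (?A h)", OF card_fooled_swaps_le] by simp
  also have "\<dots> \<le> N * 2 ^ r" using \<open>card (traces G U) \<le> N\<close> by (rule mult_le_mono1)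
  finally show ?thesis .
qed

lemma card_swap_on_preimage:
  assumes "\<sigma> \<subseteq> {..<2*r}"
  shows "card {z \<in> samples X (2*r) \<times> samples X (2*r). swap_on \<sigma> z \<in> fooled_pairs r X G}
    = card (fooled_pairs r X G)" (is "card ?A = card ?B")
proof (rule bij_betw_same_card)
  show "bij_betw (swap_on \<sigma>) ?A ?B"
  proof (rule bij_betw_byWitness[of _ "swap_on \<sigma>"])
    show "swap_on \<sigma> ` ?B \<subseteq> ?A"
    proof
      fix y assume "y \<in> swap_on \<sigma> ` ?B"
      then obtain z where z: "y = swap_on \<sigma> z" "z \<in> ?B" by blast
      then have "z \<in> samples X (2*r) \<times> samples X (2*r)" unfolding fooled_pairs_def by blast
      then show "y \<in> ?A" using swap_on_samples[OF assms] z by (simp add: swap_on_swap_on)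
    qed
  qed (auto simp: swap_on_swap_on)
qed

lemma few_fooled_pairs:
  assumes "finite X"
    and traces: "\<And>U. U \<subseteq> X \<Longrightarrow> card U \<le> 4 * r \<Longrightarrow> card (traces G U) \<le> N"
  shows "2 ^ r * card (fooled_pairs r X G) \<le> card (samples X (2*r)) * card (samples X (2*r)) * N"
proof -
  let ?\<Omega> = "samples X (2*r)" and ?B = "fooled_pairs r X G"
  have fin: "finite ?\<Omega>" by (rule finite_samples[OF assms(1)])
  have "(2::nat) ^ r * (2 ^ r * card ?B) = 2 ^ (2*r) * card ?B"
    by (simp add: mult_2 power_add)
  also have "\<dots> = (\<Sum>\<sigma>\<in>Pow {..<2*r}. card {z \<in> ?\<Omega> \<times> ?\<Omega>. swap_on \<sigma> z \<in> ?B})"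
    by (simp add: card_swap_on_preimage card_Pow)
  also have "\<dots> = (\<Sum>z\<in>?\<Omega> \<times> ?\<Omega>. card {\<sigma>\<in>Pow {..<2*r}. swap_on \<sigma> z \<in> ?B})"
    by (rule sum_multicount_gen) (use fin in auto)
  also have "\<dots> \<le> card (?\<Omega> \<times> ?\<Omega>) * (N * 2 ^ r)"
    using sum_bounded_above[of "?\<Omega> \<times> ?\<Omega>",
        OF card_swaps_into_fooled_pairs_le[OF assms(1) _ traces]] by simp
  also have "\<dots> = 2 ^ r * (card ?\<Omega> * card ?\<Omega> * N)"
    by (simp add: card_cartesian_product)
  finally show ?thesis by simp
qed

text \<open>Double sampling: a sample lying inside a small set \<open>g\<close> typically comes with a second sample
  of which \<open>g\<close> contains at most half; exchanging entries of the two samples at random makes this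
  unlikely.\<close>

theorem double_sampling_net:
  assumes X: "finite X" "X \<noteq> {}"
    and G: "\<And>g. g \<in> G \<Longrightarrow> g \<subseteq> X \<and> 4 * card g \<le> card X"
    and traces: "\<And>U. U \<subseteq> X \<Longrightarrow> card U \<le> 4 * r \<Longrightarrow> card (traces G U) \<le> N"
    and N: "2 * N < 2 ^ r"
  shows "\<exists>U\<subseteq>X. card U \<le> 2 * r \<and> (\<forall>g\<in>G. \<not> U \<subseteq> g)"
proof (rule ccontr)
  assume no_net: "\<not> ?thesis"
  let ?\<Omega> = "samples X (2*r)"
  have covered: "\<exists>g\<in>G. \<forall>j<2*r. f j \<in> g" if "f \<in> ?\<Omega>" for f
  proof -
    have "f ` {..<2*r} \<subseteq> X" "card (f ` {..<2*r}) \<le> 2 * r"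
      using sample_in[OF that] card_image_le[of "{..<2*r}" f] by auto
    then obtain g where "g \<in> G" "f ` {..<2*r} \<subseteq> g" using no_net by blast
    then show ?thesis by blast
  qed
  have "card ?\<Omega> * card ?\<Omega> \<le> 2 * card (fooled_pairs r X G)"
    by (rule many_fooled_pairs[OF X G covered])
  then have "2 ^ r * (card ?\<Omega> * card ?\<Omega>) \<le> 2 * (2 ^ r * card (fooled_pairs r X G))"
    using mult_le_mono2[of _ _ "2 ^ r"] by (metis mult.left_commute)
  also have "\<dots> \<le> 2 * N * (card ?\<Omega> * card ?\<Omega>)"
    using few_fooled_pairs[of X r, OF X(1) traces] by (simp add: mult.commute)
  finally have "2 ^ r * (card ?\<Omega> * card ?\<Omega>) \<le> 2 * N * (card ?\<Omega> * card ?\<Omega>)" .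
  moreover have "card ?\<Omega> * card ?\<Omega> > 0"
    using X by (simp add: samples_def card_PiE card_gt_0_iff)
  ultimately have "2 ^ r \<le> 2 * N" by (simp only: mult_le_cancel2)
  then show False using N by simp
qed

section \<open>Nets for hyperedges close to a common set\<close>

definition nsets_missing :: "'a set \<Rightarrow> nat \<Rightarrow> 'a set \<Rightarrow> 'a set set" where
  "nsets_missing P t e = {S \<in> nsets P t. \<not> S \<subseteq> e}"

lemma card_nsets_containing:
  assumes "finite P" "x \<in> P" "1 \<le> t"
  shows "card {S \<in> nsets P t. x \<in> S} = (card P - 1) choose (t - 1)"
proof -
  have "card {S \<in> nsets P t. x \<in> S} = card (nsets (P - {x}) (t - 1))"
  proof (rule bij_betw_same_card[of "\<lambda>S. S - {x}"], rule bij_betw_byWitness[of _ "insert x"])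
    show "(\<lambda>S. S - {x}) ` {S \<in> nsets P t. x \<in> S} \<subseteq> nsets (P - {x}) (t - 1)"
      by (auto simp: nsets_def)
    show "insert x ` nsets (P - {x}) (t - 1) \<subseteq> {S \<in> nsets P t. x \<in> S}"
    proof
      fix S assume "S \<in> insert x ` nsets (P - {x}) (t - 1)"
      then obtain S' where S': "S = insert x S'" "S' \<subseteq> P - {x}" "finite S'" "card S' = t - 1"
        by (auto simp: nsets_def)
      then have "x \<notin> S'" by auto
      then show "S \<in> {S \<in> nsets P t. x \<in> S}" using S' assms(2,3) by (auto simp: nsets_def)
    qed
  qed (auto simp: nsets_def)
  then show ?thesis using assms(1,2) by (simp add: card_nsets card_Diff_singleton)
qed

lemma card_nsets_missing_le:
  assumes "finite P" "1 \<le> t"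
  shows "card P * card (nsets_missing P t e) \<le> t * card (P - e) * card (nsets P t)"
proof -
  have "nsets_missing P t e \<subseteq> (\<Union>x\<in>P - e. {S \<in> nsets P t. x \<in> S})"
    unfolding nsets_missing_def nsets_def by auto
  then have "card (nsets_missing P t e) \<le> card (\<Union>x\<in>P - e. {S \<in> nsets P t. x \<in> S})"
    using assms(1) by (intro card_mono) (auto simp: finite_imp_finite_nsets)
  also have "\<dots> \<le> (\<Sum>x\<in>P - e. card {S \<in> nsets P t. x \<in> S})"
    using assms(1) by (intro card_UN_le) auto
  also have "\<dots> = card (P - e) * ((card P - 1) choose (t - 1))"
    by (simp add: card_nsets_containing[OF assms(1) _ assms(2)])
  finally have "card P * card (nsets_missing P t e)
      \<le> card P * (card (P - e) * ((card P - 1) choose (t - 1)))"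
    by (rule mult_le_mono2)
  also have "\<dots> = card (P - e) * (card P * ((card P - 1) choose (t - 1)))"
    by (rule mult.left_commute)
  also have "card P * ((card P - 1) choose (t - 1)) = t * card (nsets P t)"
    using times_binomial_minus1_eq[of t "card P"] assms by (simp add: card_nsets)
  finally show ?thesis by (simp add: mult.left_commute mult.commute)
qed

lemma card_nsets_missing_le_quarter:
  assumes P: "finite P" "1 \<le> t" "t \<le> card P" and close: "4 * t * card (P - e) \<le> card P"
  shows "4 * card (nsets_missing P t e) \<le> card (nsets P t)"
proof -
  have "card P * (4 * card (nsets_missing P t e)) = 4 * (card P * card (nsets_missing P t e))"
    by (rule mult.left_commute)
  also have "\<dots> \<le> 4 * (t * card (P - e) * card (nsets P t))"
    by (intro mult_le_mono2 card_nsets_missing_le P)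
  also have "\<dots> = 4 * t * card (P - e) * card (nsets P t)" by (simp only: mult.assoc)
  also have "\<dots> \<le> card P * card (nsets P t)" using close by (rule mult_le_mono1)
  finally show ?thesis using P(2,3) by simp
qed

lemma card_traces_nsets_missing_le:
  assumes "finite P" and U: "U \<subseteq> nsets P t" and vc: "vc_dim_le E d"
  shows "card (traces (nsets_missing P t ` E) U) \<le> (card U * t + 1) ^ d"
proof -
  have fin: "finite (\<Union>U)"
    by (rule finite_subset[OF _ assms(1)]) (use U in \<open>auto simp: nsets_def\<close>)
  have "nsets_missing P t e \<inter> U = {S\<in>U. \<not> S \<subseteq> e \<inter> \<Union>U}" for e
    using U unfolding nsets_missing_def by (auto simp: Sup_upper)
  then have "traces (nsets_missing P t ` E) U = (\<lambda>Q. {S\<in>U. \<not> S \<subseteq> Q}) ` traces E (\<Union>U)"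
    unfolding traces_def by (simp add: image_image)
  then have "card (traces (nsets_missing P t ` E) U) \<le> card (traces E (\<Union>U))"
    using finite_traces[OF fin] by (simp add: card_image_le)
  also have "\<dots> \<le> (card (\<Union>U) + 1) ^ d" by (rule card_traces_le[OF vc fin])
  also have "\<dots> \<le> (card U * t + 1) ^ d"
  proof (rule power_mono)
    have "card (\<Union>U) \<le> (\<Sum>S\<in>U. card S)" by (rule card_Union_le_sum_card)
    also have "\<dots> = card U * t" using U by (simp add: nsets_def subset_iff)
    finally show "card (\<Union>U) + 1 \<le> card U * t + 1" by simp
  qed simp
  finally show ?thesis .
qed

lemma net_size_suffices:
  assumes "1 \<le> d" "1 \<le> t"
  shows "2 * (4 * (8 * d\<^sup>2 * t) * t + 1) ^ d < 2 ^ (8 * d\<^sup>2 * t)"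
proof -
  define m where "m = d * t"
  have m: "1 \<le> m" "m \<le> d\<^sup>2 * t" "d \<le> d\<^sup>2 * t"
    using assms by (auto simp: m_def power2_eq_square)
  have "m \<le> 2 ^ (m - 1)" using less_exp[of "m - 1"] m(1) by linarith
  then have "m * m \<le> 2 ^ (m - 1) * 2 ^ (m - 1)" by (intro mult_mono) auto
  moreover have "4 * (8 * d\<^sup>2 * t) * t + 1 \<le> 64 * (m * m)"
    using m(1) mult_le_mono[OF m(1) m(1)] by (simp add: m_def power2_eq_square mult_ac)
  ultimately have "4 * (8 * d\<^sup>2 * t) * t + 1 \<le> 64 * (2 ^ (m - 1) * 2 ^ (m - 1))" by linarith
  also have "\<dots> = 2 ^ (6 + ((m - 1) + (m - 1)))" by (simp only: power_add) simp
  also have "6 + ((m - 1) + (m - 1)) = 4 + 2 * m" using m(1) by simp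
  finally have "(4 * (8 * d\<^sup>2 * t) * t + 1) ^ d \<le> (2 ^ (4 + 2 * m)) ^ d" by (rule power_mono) simp
  also have "\<dots> = 2 ^ ((4 + 2 * m) * d)" by (rule power_mult[symmetric])
  finally have "2 * (4 * (8 * d\<^sup>2 * t) * t + 1) ^ d \<le> 2 ^ Suc ((4 + 2 * m) * d)" by simp
  also have "\<dots> < 2 ^ (8 * d\<^sup>2 * t)"
  proof (rule power_strict_increasing)
    have "(4 + 2 * m) * d = 4 * d + 2 * (d\<^sup>2 * t)"
      by (simp add: m_def power2_eq_square algebra_simps)
    then show "Suc ((4 + 2 * m) * d) < 8 * d\<^sup>2 * t" using m by linarith
  qed simp
  finally show ?thesis .
qed

theorem net_for_close_hyperedges:
  assumes P: "finite P" "1 \<le> t" "t \<le> card P" and d: "1 \<le> d" "vc_dim_le E d"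
    and close: "\<And>e. e \<in> E \<Longrightarrow> 4 * t * card (P - e) \<le> card P"
  shows "\<exists>N\<subseteq>nsets P t. card N \<le> 16 * d\<^sup>2 * t \<and> (\<forall>e\<in>E. \<exists>S\<in>N. S \<subseteq> e)"
proof -
  let ?r = "8 * d\<^sup>2 * t"
  have "\<exists>U\<subseteq>nsets P t. card U \<le> 2 * ?r \<and> (\<forall>g\<in>nsets_missing P t ` E. \<not> U \<subseteq> g)"
  proof (rule double_sampling_net[OF _ _ _ _ net_size_suffices[OF d(1) P(2)]])
    show "finite (nsets P t)" using P(1) by (rule finite_imp_finite_nsets)
    show "nsets P t \<noteq> {}" using P by (simp add: nsets_eq_empty_iff)
    show "g \<subseteq> nsets P t \<and> 4 * card g \<le> card (nsets P t)" if "g \<in> nsets_missing P t ` E" for g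
      using that card_nsets_missing_le_quarter[OF P close] by (auto simp: nsets_missing_def)
    show "card (traces (nsets_missing P t ` E) U) \<le> (4 * ?r * t + 1) ^ d"
      if U: "U \<subseteq> nsets P t" "card U \<le> 4 * ?r" for U
    proof -
      have "(card U * t + 1) ^ d \<le> (4 * ?r * t + 1) ^ d"
        using mult_le_mono1[OF U(2), of t] by (intro power_mono) auto
      then show ?thesis
        using card_traces_nsets_missing_le[OF P(1) U(1) d(2)] by (rule order_trans[rotated])
    qed
  qed
  then obtain U where U: "U \<subseteq> nsets P t" "card U \<le> 2 * ?r"
      "\<forall>g\<in>nsets_missing P t ` E. \<not> U \<subseteq> g" by blast
  have "\<exists>S\<in>U. S \<subseteq> e" if "e \<in> E" for e
  proof -
    have "\<not> U \<subseteq> nsets_missing P t e" using U(3) that by blast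
    then show ?thesis using U(1) unfolding nsets_missing_def by blast
  qed
  moreover have "card U \<le> 16 * d\<^sup>2 * t" using U(2) by simp
  ultimately show ?thesis using U(1) by blast
qed

section \<open>Sparse hypergraphs\<close>

lemma dyadic_scale:
  fixes a x :: real
  assumes "a \<le> x" "x < a * 2 ^ n"
  shows "\<exists>j<n. a * 2 ^ j \<le> x \<and> x < 2 * (a * 2 ^ j)"
  using assms
proof (induction n)
  case (Suc n)
  then show ?case
    by (cases "x < a * 2 ^ n") (auto simp: less_Suc_eq not_less)
qed simp

definition shallow_pairs :: "'a set set \<Rightarrow> nat \<Rightarrow> 'a set \<Rightarrow> 'a set set" where
  "shallow_pairs H m R = {S. card S = 2 \<and> (\<exists>Q\<in>traces H R. S \<subseteq> Q \<and> card Q \<le> m)}"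

lemma finite_shallow_pairs: "finite R \<Longrightarrow> finite (shallow_pairs H m R)"
  using traces_subset_Pow[of H R]
  by (intro finite_subset[of "shallow_pairs H m R" "Pow R"]) (auto simp: shallow_pairs_def)

lemma edges_in_shallow_pairs_subset:
  assumes "finite R" "R' \<subseteq> R"
  shows "edges_in (shallow_pairs H m R) R' \<subseteq> shallow_pairs H m R'"
proof
  fix S assume S: "S \<in> edges_in (shallow_pairs H m R) R'"
  then obtain e where e: "e \<in> H" "S \<subseteq> e \<inter> R" "card (e \<inter> R) \<le> m"
    unfolding edges_in_def shallow_pairs_def traces_def by blast
  have "card (e \<inter> R') \<le> card (e \<inter> R)" using assms by (intro card_mono) auto
  then have "e \<inter> R' \<in> traces H R'" "S \<subseteq> e \<inter> R'" "card (e \<inter> R') \<le> m"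
    using e S unfolding edges_in_def traces_def by auto
  moreover have "card S = 2" using S unfolding edges_in_def by blast
  ultimately show "S \<in> shallow_pairs H m R'" unfolding shallow_pairs_def by blast
qed

lemma trace_survives_sampling:
  assumes R: "finite R" and Q: "Q \<in> traces H R" "S \<subseteq> Q" "card Q \<le> m" and p: "0 \<le> p" "p \<le> 1"
  shows "p ^ card S * (1 - real m * p) \<le> expect p R (\<lambda>R'. of_bool (S \<in> traces H R'))"
proof -
  have QR: "Q \<subseteq> R" using Q(1) traces_subset_Pow by blast
  have "card (Q - S) \<le> m"
    using card_mono[OF finite_subset[OF QR R] Diff_subset[of Q S]] Q(3) by linarith
  have "1 + real m * (- p) \<le> (1 + (- p)) ^ m" using p by (intro Bernoulli_inequality) auto
  also have "\<dots> \<le> (1 - p) ^ card (Q - S)"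
    using p \<open>card (Q - S) \<le> m\<close> by (simp add: power_decreasing)
  finally have "p ^ card S * (1 - real m * p) \<le> p ^ card S * (1 - p) ^ card (Q - S)"
    using p by (intro mult_left_mono) auto
  also have "\<dots> = expect p R (\<lambda>R'. of_bool (R' \<inter> Q = S))"
    by (rule expect_of_bool_Int[OF R Q(2) QR, symmetric])
  also have "\<dots> \<le> expect p R (\<lambda>R'. of_bool (S \<in> traces H R'))"
  proof (intro expect_mono p)
    fix R' assume "R' \<subseteq> R"
    obtain e where e: "e \<in> H" "Q = e \<inter> R" using Q(1) unfolding traces_def by blast
    have "e \<inter> R' = R' \<inter> Q" using \<open>R' \<subseteq> R\<close> e(2) by blast
    then show "of_bool (R' \<inter> Q = S) \<le> (of_bool (S \<in> traces H R') :: real)"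
      using e(1) unfolding traces_def by auto
  qed
  finally show ?thesis .
qed

definition shallow_factor :: "nat \<Rightarrow> nat \<Rightarrow> nat \<Rightarrow> nat" where
  "shallow_factor c d m = (8 * c * m + 1) ^ (d - 1)"

lemma shallow_factor_mult_le:
  assumes "1 \<le> t"
  shows "shallow_factor c d (a * t) \<le> shallow_factor c d a * t ^ (d - 1)"
proof -
  have "8 * c * (a * t) + 1 \<le> (8 * c * a + 1) * t" using assms by (simp add: algebra_simps)
  then have "shallow_factor c d (a * t) \<le> ((8 * c * a + 1) * t) ^ (d - 1)"
    unfolding shallow_factor_def by (rule power_mono) simp
  then show ?thesis by (simp only: shallow_factor_def power_mult_distrib)
qed

definition net_factor :: "nat \<Rightarrow> nat \<Rightarrow> real" where
  "net_factor c d = 2048 * real d ^ 3 * real (shallow_factor c d (256 * d))"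

locale sparse_hypergraph =
  fixes V :: "'a set" and H :: "'a set set" and d c :: nat
  assumes finite_V: "finite V" and H_sub: "H \<subseteq> Pow V"
    and d_pos: "1 \<le> d" and vc: "vc_dim_le H d"
    and sparse: "R \<subseteq> V \<Longrightarrow> card {S \<in> traces H R. card S = 2} \<le> c * card R"
begin

lemma finite_H: "finite H"
  using finite_subset[OF H_sub] finite_V by simp

text \<open>Clarkson--Shor: a pair lying in a small trace becomes a full trace on a random subset with
  probability of order \<open>1 / m\<^sup>2\<close>.\<close>

lemma card_shallow_pairs_le:
  assumes R: "R \<subseteq> V" and m: "m \<ge> 1"
  shows "card (shallow_pairs H m R) \<le> 4 * c * m * card R"
proof -
  let ?G = "shallow_pairs H m R"
  define p where "p = 1 / (2 * real m)"
  have p: "0 < p" "p \<le> 1" "real m * p = 1 / 2" using m by (auto simp: p_def divide_simps)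
  have finR: "finite R" using R finite_V finite_subset by blast
  note finG = finite_shallow_pairs[OF finR, of H m]
  have "p\<^sup>2 * (1 / 2) \<le> expect p R (\<lambda>R'. of_bool (S \<in> traces H R'))" if S: "S \<in> ?G" for S
  proof -
    obtain Q where "Q \<in> traces H R" "S \<subseteq> Q" "card Q \<le> m" "card S = 2"
      using S unfolding shallow_pairs_def by blast
    then show ?thesis using trace_survives_sampling[OF finR, of Q H S m p] p by simp
  qed
  then have "real (card ?G) * (p\<^sup>2 * (1 / 2))
      \<le> (\<Sum>S\<in>?G. expect p R (\<lambda>R'. of_bool (S \<in> traces H R')))"
    by (rule sum_bounded_below)
  also have "\<dots> = expect p R (\<lambda>R'. \<Sum>S\<in>?G. of_bool (S \<in> traces H R'))"
    by (rule expect_sum[symmetric])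
  also have "\<dots> \<le> expect p R (\<lambda>R'. real c * real (card (R' \<inter> R)))"
  proof (intro expect_mono)
    fix R' assume R': "R' \<subseteq> R"
    have "(\<Sum>S\<in>?G. of_bool (S \<in> traces H R')) = real (card {S\<in>?G. S \<in> traces H R'})"
      using finG by (simp add: Int_def)
    also have "card {S\<in>?G. S \<in> traces H R'} \<le> card {S \<in> traces H R'. card S = 2}"
      using finite_traces[OF finite_subset[OF R' finR]]
      by (intro card_mono) (auto simp: shallow_pairs_def)
    also have "\<dots> \<le> c * card (R' \<inter> R)" using sparse[of R'] R' R by (simp add: Int_absorb2)
    finally show "(\<Sum>S\<in>?G. of_bool (S \<in> traces H R')) \<le> real c * real (card (R' \<inter> R))" by simp
  qed (use p in auto)
  also have "\<dots> = real c * (p * real (card R))"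
    by (simp only: expect_cmult expect_card_Int[OF finR subset_refl])
  finally have "real (card ?G) * p \<le> 2 * real c * real (card R)"
    using p(1) by (simp add: power2_eq_square field_simps)
  then have "real (card ?G) \<le> real (4 * c * m * card R)"
    using m by (simp add: p_def field_simps)
  then show ?thesis by (simp only: of_nat_le_iff)
qed

lemma card_shallow_traces_le:
  assumes R: "R \<subseteq> V" and m: "m \<ge> 1"
  shows "card {Q \<in> traces H R. card Q \<le> m} \<le> 1 + card R * shallow_factor c d m"
proof -
  let ?F = "{Q \<in> traces H R. card Q \<le> m}" and ?C = "cliques (shallow_pairs H m R) R (Suc (d - 1))"
  have finR: "finite R" using R finite_V finite_subset by blast
  have "?F \<subseteq> Pow R" using traces_subset_Pow by blast
  have "card ?F \<le> card {S. shatters ?F S}" by (rule card_le_card_shattered[OF finR \<open>?F \<subseteq> Pow R\<close>])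
  also have "\<dots> \<le> card (insert {} ?C)"
  proof (rule card_mono)
    show "finite (insert {} ?C)" using finite_cliques[OF finR] by simp
    show "{S. shatters ?F S} \<subseteq> insert {} ?C"
    proof
      fix S assume "S \<in> {S. shatters ?F S}"
      then have S: "shatters ?F S" by simp
      then have "shatters (traces H R) S" by (rule shatters_mono) simp
      then have "card S \<le> d" by (rule vc_dim_leD[OF vc_dim_le_traces[OF vc]])
      moreover have "S \<subseteq> R" by (rule shatters_subset[OF \<open>?F \<subseteq> Pow R\<close> S])
      moreover obtain Q where "Q \<in> ?F" "Q \<inter> S = S" by (rule shattersE[OF S subset_refl])
      then have "T \<in> shallow_pairs H m R" if "T \<subseteq> S" "card T = 2" for T
        using that unfolding shallow_pairs_def by blast
      ultimately show "S \<in> insert {} ?C" unfolding cliques_def by auto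
    qed
  qed
  also have "\<dots> \<le> 1 + card ?C"
    using finite_cliques[OF finR] by (simp add: card_insert_if)
  also have "card ?C \<le> card R * (2 * (4 * c * m) + 1) ^ (d - 1)"
  proof (rule card_cliques_le[OF finR])
    fix R' assume R': "R' \<subseteq> R"
    have "card (edges_in (shallow_pairs H m R) R') \<le> card (shallow_pairs H m R')"
      using finite_shallow_pairs[OF finite_subset[OF R' finR]]
      by (rule card_mono) (rule edges_in_shallow_pairs_subset[OF finR R'])
    also have "\<dots> \<le> 4 * c * m * card R'" using R' R m by (intro card_shallow_pairs_le) auto
    finally show "card (edges_in (shallow_pairs H m R) R') \<le> 4 * c * m * card R'" .
  qed
  finally show ?thesis by (simp add: shallow_factor_def mult.assoc)
qed

lemma card_traces_le_shallow:
  assumes F: "F \<subseteq> H" and R: "R \<subseteq> V" and m: "m \<ge> 1"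
  shows "real (card (traces F R)) \<le> 1 + real (shallow_factor c d m) * real (card (R \<inter> V))
    + (\<Sum>e\<in>F. 1 / real m * real (card (R \<inter> e)))"
proof -
  let ?deep = "{e\<in>F. m < card (R \<inter> e)}"
  have fin: "finite F" "finite R"
    using finite_subset[OF F finite_H] finite_subset[OF R finite_V] by auto
  have "traces F R \<subseteq> {Q \<in> traces H R. card Q \<le> m} \<union> (\<lambda>e. e \<inter> R) ` ?deep"
    using F unfolding traces_def by (auto simp: Int_commute)
  then have "card (traces F R) \<le> card ({Q \<in> traces H R. card Q \<le> m} \<union> (\<lambda>e. e \<inter> R) ` ?deep)"
    using fin(1) finite_traces[OF fin(2), of H] by (intro card_mono) auto
  also have "\<dots> \<le> card {Q \<in> traces H R. card Q \<le> m} + card ((\<lambda>e. e \<inter> R) ` ?deep)"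
    by (rule card_Un_le)
  also have "\<dots> \<le> (1 + card R * shallow_factor c d m) + card ?deep"
    using fin(1) by (intro add_mono card_shallow_traces_le R m card_image_le) auto
  finally have "real (card (traces F R)) \<le> real ((1 + card R * shallow_factor c d m) + card ?deep)"
    by (simp only: of_nat_le_iff)
  moreover have "real (card ?deep) \<le> (\<Sum>e\<in>F. 1 / real m * real (card (R \<inter> e)))"
  proof -
    have "real (card ?deep) = (\<Sum>e\<in>?deep. 1)" by simp
    also have "\<dots> \<le> (\<Sum>e\<in>?deep. 1 / real m * real (card (R \<inter> e)))"
      using m by (intro sum_mono) auto
    also have "\<dots> \<le> (\<Sum>e\<in>F. 1 / real m * real (card (R \<inter> e)))"
      using fin(1) by (intro sum_mono2) auto
    finally show ?thesis .
  qed
  ultimately show ?thesis using R by (simp add: Int_absorb2 mult.commute)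
qed

lemma expect_card_traces_le:
  assumes F: "F \<subseteq> H" and size: "\<And>e. e \<in> F \<Longrightarrow> real (card e) \<le> K"
    and p: "0 \<le> p" "p \<le> 1" and m: "m \<ge> 1" "4 * K * p \<le> real m"
  shows "expect p V (\<lambda>R. real (card (traces F R)))
    \<le> 1 + p * real (card V) * real (shallow_factor c d m) + real (card F) / 4"
proof -
  have "expect p V (\<lambda>R. real (card (traces F R)))
      \<le> expect p V (\<lambda>R. 1 + real (shallow_factor c d m) * real (card (R \<inter> V))
          + (\<Sum>e\<in>F. 1 / real m * real (card (R \<inter> e))))"
    using card_traces_le_shallow[OF F _ m(1)] by (intro expect_mono p)
  also have "\<dots> = 1 + real (shallow_factor c d m) * (p * real (card V))
      + (\<Sum>e\<in>F. 1 / real m * expect p V (\<lambda>R. real (card (R \<inter> e))))"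
    by (simp only: expect_add expect_cmult expect_sum expect_const[OF finite_V]
        expect_card_Int[OF finite_V subset_refl])
  also have "(\<Sum>e\<in>F. 1 / real m * expect p V (\<lambda>R. real (card (R \<inter> e)))) \<le> real (card F) * (1 / 4)"
  proof (rule sum_bounded_above)
    fix e assume e: "e \<in> F"
    then have "e \<subseteq> V" using F H_sub by blast
    then have "4 * expect p V (\<lambda>R. real (card (R \<inter> e))) = 4 * real (card e) * p"
      by (simp add: expect_card_Int[OF finite_V])
    also have "\<dots> \<le> 4 * K * p" using size[OF e] p(1) by (intro mult_right_mono) auto
    finally show "1 / real m * expect p V (\<lambda>R. real (card (R \<inter> e))) \<le> 1 / 4"
      using m by (simp add: field_simps)
  qed
  finally show ?thesis by (simp add: mult_ac)
qed

lemma shallow_packing: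
  assumes F: "F \<subseteq> H" "\<And>e. e \<in> F \<Longrightarrow> real (card e) \<le> K" and sep: "separated \<delta> F"
    and p: "0 \<le> p" "p \<le> 1" "8 * real d \<le> p * \<delta>" and m: "m \<ge> 1" "4 * K * p \<le> real m"
  shows "real (card F) \<le> 2 * (1 + p * real (card V) * real (shallow_factor c d m))"
proof -
  let ?T = "expect p V (\<lambda>R. real (card (traces F R)))"
  have "F \<subseteq> Pow V" using F(1) H_sub by blast
  then have packing: "p * \<delta> / 2 * (real (card F) - ?T) \<le> real d * real (card F)"
    by (rule haussler_packing[OF finite_V _ vc_dim_le_subset[OF vc F(1)] sep p(1,2)])
  have "3 * real (card F) \<le> 4 * ?T"
  proof (cases "real (card F) \<le> ?T")
    case False
    then have "real d * 4 * (real (card F) - ?T) \<le> p * \<delta> / 2 * (real (card F) - ?T)"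
      using p(3) by (intro mult_right_mono) auto
    then have "real d * 4 * (real (card F) - ?T) \<le> real d * real (card F)"
      using packing by (rule order_trans)
    then have "real d * (4 * (real (card F) - ?T)) \<le> real d * real (card F)"
      by (simp only: mult.assoc)
    then show ?thesis using d_pos by simp
  qed simp
  then show ?thesis using expect_card_traces_le[OF F p(1,2) m] by simp
qed

text \<open>Sampling with probability \<open>p = 32 d t / k\<close> makes the packing bound effective, if this is a
  probability; otherwise all hyperedges in question are shallow already.\<close>

lemma packing_at_scale_shallow_factor:
  fixes k :: real and t :: nat
  assumes t: "t \<ge> 1" and k: "k > 0" and F: "F \<subseteq> H" and sep: "separated (k / (4 * real t)) F"
    and size: "\<And>e. e \<in> F \<Longrightarrow> real (card e) \<le> 2 * k"
  shows "real (card F) \<le> 2 * (1 + 32 * real d * real t / k * real (card V)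
    * real (shallow_factor c d (256 * d * t)))"
proof -
  define m where "m = 256 * d * t"
  define p where "p = 32 * real d * real t / k"
  let ?B = "real (shallow_factor c d m)"
  have m: "m \<ge> 1" using t d_pos by (simp add: m_def)
  have p: "p > 0" using t d_pos k by (simp add: p_def)
  have "real (card F) \<le> 2 * (1 + p * real (card V) * ?B)"
  proof (cases "p \<le> 1")
    case True
    show ?thesis
    proof (rule shallow_packing[OF F size sep])
      show "8 * real d \<le> p * (k / (4 * real t))" using t k by (simp add: p_def field_simps)
      show "4 * (2 * k) * p \<le> real m" using k by (simp add: m_def p_def)
    qed (use p True m in auto)
  next
    case False
    have "card e \<le> m" if "e \<in> F" for e
    proof -
      have "k < 32 * real d * real t" using False k by (simp add: p_def field_simps)
      then have "real (card e) \<le> real m" using size[OF that] t by (simp add: m_def)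
      then show ?thesis by simp
    qed
    then have "F \<subseteq> {Q \<in> traces H V. card Q \<le> m}" using F traces_eq_self[OF H_sub] by auto
    then have "card F \<le> card {Q \<in> traces H V. card Q \<le> m}"
      using finite_traces[OF finite_V, of H] by (intro card_mono) auto
    also have "\<dots> \<le> 1 + card V * shallow_factor c d m"
      by (rule card_shallow_traces_le[OF subset_refl m])
    finally have "real (card F) \<le> real (1 + card V * shallow_factor c d m)"
      by (simp only: of_nat_le_iff)
    also have "\<dots> = 1 + 1 * real (card V) * ?B" by simp
    also have "\<dots> \<le> 1 + p * real (card V) * ?B"
      using False by (intro add_left_mono mult_right_mono) auto
    also have "\<dots> \<le> 2 * (1 + p * real (card V) * ?B)" using p by simp
    finally show ?thesis .
  qed
  then show ?thesis by (simp only: m_def p_def)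
qed

lemma packing_at_scale:
  fixes k :: real and t :: nat
  assumes t: "t \<ge> 1" and k: "k > 0" and F: "F \<subseteq> H" and sep: "separated (k / (4 * real t)) F"
    and size: "\<And>e. e \<in> F \<Longrightarrow> k \<le> real (card e) \<and> real (card e) < 2 * k"
  shows "real (card F)
    \<le> 128 * real d * real (shallow_factor c d (256 * d)) * real t ^ d * (real (card V) / k)"
proof (cases "F = {}")
  case True
  then show ?thesis using k by simp
next
  case False
  define p where "p = 32 * real d * real t * (real (card V) / k)"
  define B where "B = real (shallow_factor c d (256 * d * t))"
  have "B \<ge> 1" by (simp add: B_def shallow_factor_def)
  have "p \<ge> 1"
  proof -
    obtain e where "e \<in> F" using False by blast
    then have "k \<le> real (card e)" "e \<subseteq> V" using size F H_sub by blast+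
    then have "1 \<le> real (card V) / k" using card_mono[OF finite_V, of e] k by simp
    moreover have "1 \<le> 32 * real d * real t"
      using mult_mono[of 1 "real d" 1 "real t"] d_pos t by simp
    ultimately have "1 * 1 \<le> p" unfolding p_def by (intro mult_mono) auto
    then show ?thesis by simp
  qed
  then have "1 * 1 \<le> p * B" using \<open>B \<ge> 1\<close> by (intro mult_mono) auto
  moreover have "real (card F) \<le> 2 * (1 + p * B)"
    using packing_at_scale_shallow_factor[OF t k F sep] size unfolding p_def B_def
    by (simp add: less_imp_le)
  ultimately have "real (card F) \<le> 4 * (p * B)" by simp
  also have "\<dots> \<le> 4 * (p * real (shallow_factor c d (256 * d) * t ^ (d - 1)))"
    using \<open>p \<ge> 1\<close> unfolding B_def
    by (intro mult_left_mono of_nat_mono shallow_factor_mult_le[OF t]) auto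
  also have "\<dots> = 128 * real d * real (shallow_factor c d (256 * d)) * (real t ^ (d - 1) * real t)
      * (real (card V) / k)"
    by (simp add: p_def)
  also have "real t ^ (d - 1) * real t = real t ^ d"
    using d_pos by (cases d) (simp_all add: mult.commute)
  finally show ?thesis .
qed

section \<open>Nets for sparse hypergraphs\<close>

lemma net_for_close_members:
  fixes k :: real and t :: nat
  assumes t: "t \<ge> 1" and P: "P \<in> H" "real t \<le> k" "k \<le> real (card P)"
  shows "\<exists>N\<subseteq>nsets P t. card N \<le> 16 * d\<^sup>2 * t \<and>
    (\<forall>e\<in>{e\<in>H. real (card (sym_diff e P)) < k / (4 * real t)}. \<exists>S\<in>N. S \<subseteq> e)"
proof (rule net_for_close_hyperedges[OF _ t _ d_pos])
  show finP: "finite P" using P(1) H_sub finite_subset[OF _ finite_V] by blast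
  show "t \<le> card P" using P(2,3) by linarith
  show "vc_dim_le {e\<in>H. real (card (sym_diff e P)) < k / (4 * real t)} d"
    by (rule vc_dim_le_subset[OF vc]) auto
  fix e assume e: "e \<in> {e\<in>H. real (card (sym_diff e P)) < k / (4 * real t)}"
  have "card (P - e) \<le> card (sym_diff e P)"
    using e finP H_sub finite_subset[OF _ finite_V] by (intro card_mono) auto
  then have "4 * real t * real (card (P - e)) \<le> 4 * real t * (k / (4 * real t))"
    using e by (intro mult_left_mono) auto
  also have "\<dots> = k" using t by simp
  finally have "real (4 * t * card (P - e)) \<le> real (card P)" using P(3) by simp
  then show "4 * t * card (P - e) \<le> card P" by (simp only: of_nat_le_iff)
qed

lemma net_at_scale:
  fixes k :: real and t :: nat
  assumes t: "t \<ge> 1" and k: "k \<ge> real t"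
  shows "\<exists>N\<subseteq>nsets V t. real (card N) \<le> net_factor c d * real t ^ (d + 1) * (real (card V) / k) \<and>
    (\<forall>e\<in>{e\<in>H. k \<le> real (card e) \<and> real (card e) < 2 * k}. \<exists>S\<in>N. S \<subseteq> e)"
proof -
  let ?Hk = "{e\<in>H. k \<le> real (card e) \<and> real (card e) < 2 * k}"
  define \<delta> where "\<delta> = k / (4 * real t)"
  have k0: "k > 0" and \<delta>: "\<delta> > 0" using t k by (auto simp: \<delta>_def)
  have fin: "finite ?Hk" using finite_H by simp
  then obtain F where F: "F \<subseteq> ?Hk" "separated \<delta> F"
    and near: "\<And>e. e \<in> ?Hk \<Longrightarrow> \<exists>P\<in>F. real (card (sym_diff e P)) < \<delta>"
    using \<delta> by (rule maximal_separated_subfamily) blast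
  have finF: "finite F" using F(1) fin by (rule finite_subset)
  let ?net = "\<lambda>P N. N \<subseteq> nsets P t \<and> card N \<le> 16 * d\<^sup>2 * t \<and>
      (\<forall>e\<in>{e\<in>H. real (card (sym_diff e P)) < \<delta>}. \<exists>S\<in>N. S \<subseteq> e)"
  have "\<exists>N. ?net P N" if "P \<in> F" for P
    unfolding \<delta>_def by (rule net_for_close_members[OF t _ k]) (use that F(1) in auto)
  then have "\<exists>N. \<forall>P\<in>F. ?net P (N P)" by (intro bchoice ballI)
  then obtain N where N: "\<forall>P\<in>F. ?net P (N P)" by (rule exE)
  have "card (\<Union>P\<in>F. N P) \<le> (\<Sum>P\<in>F. card (N P))" by (rule card_UN_le[OF finF])
  also have "\<dots> \<le> card F * (16 * d\<^sup>2 * t)"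
    using sum_bounded_above[of F "\<lambda>P. card (N P)" "16 * d\<^sup>2 * t"] N by simp
  finally have "real (card (\<Union>P\<in>F. N P)) \<le> real (card F * (16 * d\<^sup>2 * t))"
    by (simp only: of_nat_le_iff)
  also have "\<dots> = real (card F) * (16 * real d ^ 2 * real t)" by simp
  also have "\<dots> \<le> (128 * real d * real (shallow_factor c d (256 * d)) * real t ^ d
      * (real (card V) / k)) * (16 * real d ^ 2 * real t)"
    using F unfolding \<delta>_def by (intro mult_right_mono packing_at_scale[OF t k0]) auto
  also have "\<dots> = net_factor c d * real t ^ (d + 1) * (real (card V) / k)"
    by (simp add: net_factor_def power2_eq_square power3_eq_cube)
  finally have "real (card (\<Union>P\<in>F. N P)) \<le> net_factor c d * real t ^ (d + 1) * (real (card V) / k)" .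
  moreover have "nsets P t \<subseteq> nsets V t" if "P \<in> F" for P
    using that F(1) H_sub by (intro nsets_mono) auto
  then have "(\<Union>P\<in>F. N P) \<subseteq> nsets V t" using N by blast
  moreover have "\<exists>S\<in>(\<Union>P\<in>F. N P). S \<subseteq> e" if e: "e \<in> ?Hk" for e
  proof -
    obtain P where P: "P \<in> F" "real (card (sym_diff e P)) < \<delta>" using near[OF e] by blast
    then obtain S where "S \<in> N P" "S \<subseteq> e" using bspec[OF N P(1)] e by blast
    then show ?thesis using P(1) by blast
  qed
  ultimately show ?thesis by (intro exI[of _ "\<Union>P\<in>F. N P"]) blast
qed

lemma hyperedge_dyadic_scale:
  fixes a :: real
  assumes "e \<in> H" "1 \<le> a" "a \<le> real (card e)"
  shows "\<exists>j<card V. a * 2 ^ j \<le> real (card e) \<and> real (card e) < 2 * (a * 2 ^ j)"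
proof (rule dyadic_scale[OF assms(3)])
  have "real (card e) \<le> real (card V)" using assms(1) H_sub finite_V by (auto intro: card_mono)
  also have "\<dots> < 1 * 2 ^ card V" by (simp add: of_nat_less_two_power)
  also have "\<dots> \<le> a * 2 ^ card V" using assms(2) by (intro mult_right_mono) auto
  finally show "real (card e) < a * 2 ^ card V" .
qed

theorem eps_t_net_exists:
  fixes \<epsilon> :: real and t :: nat
  assumes t: "t \<ge> 1" and \<epsilon>: "0 < \<epsilon>" and large: "real t \<le> \<epsilon> * real (card V)"
  obtains N where "eps_t_net \<epsilon> t (V, H) N"
    "real (card N) \<le> 2 * net_factor c d * real t ^ (d + 1) / \<epsilon>"
proof -
  let ?n = "card V"
  define A where "A = net_factor c d * real t ^ (d + 1) / \<epsilon>"
  define k where "k j = \<epsilon> * real ?n * 2 ^ j" for j :: nat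
  have A: "A \<ge> 0" using \<epsilon> by (simp add: A_def net_factor_def)
  have n: "real ?n > 0" using t large by (cases "?n = 0") auto
  let ?net = "\<lambda>j N. N \<subseteq> nsets V t \<and> real (card N) \<le> A * (1 / 2) ^ j \<and>
      (\<forall>e\<in>{e\<in>H. k j \<le> real (card e) \<and> real (card e) < 2 * k j}. \<exists>S\<in>N. S \<subseteq> e)"
  have "\<exists>N. ?net j N" for j
  proof -
    have "\<epsilon> * real ?n * 1 \<le> k j" unfolding k_def using \<epsilon> by (intro mult_left_mono) auto
    then have "real t \<le> k j" using large by simp
    moreover have "net_factor c d * real t ^ (d + 1) * (real ?n / k j) = A * (1 / 2) ^ j"
      using n by (simp add: A_def k_def power_divide)
    ultimately show ?thesis using net_at_scale[OF t, of "k j"] by simp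
  qed
  then have "\<exists>N. \<forall>j. ?net j (N j)" by (intro choice allI)
  then obtain N where N: "\<forall>j. ?net j (N j)" by (rule exE)
  show ?thesis
  proof (rule that[of "\<Union>j<?n. N j"])
    have "real (card (\<Union>j<?n. N j)) \<le> (\<Sum>j<?n. real (card (N j)))"
      unfolding of_nat_sum[symmetric] of_nat_le_iff by (rule card_UN_le) simp
    also have "\<dots> \<le> A * (\<Sum>j<?n. (1 / 2) ^ j)"
      unfolding sum_distrib_left using N by (intro sum_mono) simp
    also have "\<dots> \<le> A * 2"
      using A by (intro mult_left_mono) (simp_all add: sum_gp_strict)
    also have "\<dots> = 2 * net_factor c d * real t ^ (d + 1) / \<epsilon>" by (simp add: A_def)
    finally show "real (card (\<Union>j<?n. N j)) \<le> 2 * net_factor c d * real t ^ (d + 1) / \<epsilon>" .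
    have "\<exists>S\<in>(\<Union>j<?n. N j). S \<subseteq> e" if e: "e \<in> H" "\<epsilon> * real ?n \<le> real (card e)" for e
    proof -
      obtain j where j: "j < ?n" "k j \<le> real (card e)" "real (card e) < 2 * k j"
        using hyperedge_dyadic_scale[OF e(1) _ e(2)] large t by (auto simp: k_def)
      then obtain S where "S \<in> N j" "S \<subseteq> e" using spec[OF N, of j] e(1) by blast
      then show ?thesis using j(1) by blast
    qed
    moreover have "(\<Union>j<?n. N j) \<subseteq> nsets V t" using N by blast
    ultimately show "eps_t_net \<epsilon> t (V, H) (\<Union>j<?n. N j)"
      unfolding eps_t_net_def fst_conv snd_conv by blast
  qed
qed

end

section \<open>Nets for pseudo-discs\<close>

lemma traces_meeting: "R \<subseteq> V \<Longrightarrow> traces (meeting V ` F2) R = meeting R ` F2"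
  unfolding traces_def image_image meeting_def by (intro image_cong) auto

lemma (in two_pseudo_disc_families) vc_dim_le_meeting:
  "vc_dim_le (meeting F1 ` F2) 4"
  unfolding vc_dim_le_def
proof (intro allI impI, rule ccontr)
  let ?H = "meeting F1 ` F2"
  fix S assume S: "shatters ?H S" and "\<not> card S \<le> 4"
  then obtain T where T: "T \<subseteq> S" "card T = 5"
    using obtain_subset_with_card_n[of 5 S] by auto
  have "?H \<subseteq> Pow F1" unfolding meeting_def by blast
  then have TF: "T \<subseteq> F1" using shatters_subset[OF _ S] T(1) by blast
  have "Pow T \<subseteq> meeting T ` F2"
    using shatters_antimono[OF S T(1)] unfolding shatters_def traces_meeting[OF TF] .
  then show False using no_shattered_five[OF TF T(2)] by blast
qed

lemma (in two_pseudo_disc_families) sparse_hypergraph_meeting: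
  assumes "finite F1"
  shows "sparse_hypergraph F1 (meeting F1 ` F2) 4 512"
proof
  show "meeting F1 ` F2 \<subseteq> Pow F1" unfolding meeting_def by blast
  show "card {S \<in> traces (meeting F1 ` F2) R. card S = 2} \<le> 512 * card R" if R: "R \<subseteq> F1" for R
    using delaunay_edges_linear[OF finite_subset[OF R assms] R] unfolding traces_meeting[OF R] .
qed (use assms vc_dim_le_meeting in auto)

theorem theorem7:
  shows "\<exists>C::real. C > 0 \<and>
    (\<forall>(t::nat) (\<epsilon>::real) (n::nat) (F1::complex set set) (F2::complex set set).
       t \<ge> 1 \<longrightarrow> 0 < \<epsilon> \<longrightarrow> \<epsilon> < 1 \<longrightarrow>
       pseudo_discs F1 \<longrightarrow> pseudo_discs F2 \<longrightarrow>
       finite F1 \<longrightarrow> card F1 = n \<longrightarrow> \<epsilon> * real n \<ge> 2 * real t \<longrightarrow>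
       (\<exists>N. eps_t_net \<epsilon> t (intersection_hypergraph F1 F2) N \<and>
            real (card N) \<le> C * real t ^ 5 / \<epsilon>))"
proof (intro exI[of _ "2 * net_factor 512 4"] conjI allI impI)
  show "0 < 2 * net_factor 512 4" by (simp add: net_factor_def shallow_factor_def)
  fix t n :: nat and \<epsilon> :: real and F1 F2 :: "complex set set"
  assume "t \<ge> 1" "0 < \<epsilon>" "pseudo_discs F1" "pseudo_discs F2" "finite F1" "card F1 = n"
    and "\<epsilon> * real n \<ge> 2 * real t"
  interpret two_pseudo_disc_families F1 F2 by unfold_locales fact+
  interpret sparse_hypergraph F1 "meeting F1 ` F2" 4 512
    by (rule sparse_hypergraph_meeting) fact
  have "real t \<le> \<epsilon> * real (card F1)"
    using \<open>\<epsilon> * real n \<ge> 2 * real t\<close> \<open>card F1 = n\<close> by simp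
  then obtain N where "eps_t_net \<epsilon> t (F1, meeting F1 ` F2) N"
    "real (card N) \<le> 2 * net_factor 512 4 * real t ^ (4 + 1) / \<epsilon>"
    using eps_t_net_exists[OF \<open>t \<ge> 1\<close> \<open>0 < \<epsilon>\<close>] by blast
  moreover have "intersection_hypergraph F1 F2 = (F1, meeting F1 ` F2)"
    unfolding intersection_hypergraph_def meeting_def by simp
  ultimately show "\<exists>N. eps_t_net \<epsilon> t (intersection_hypergraph F1 F2) N \<and>
      real (card N) \<le> 2 * net_factor 512 4 * real t ^ 5 / \<epsilon>"
    by auto
qed

end
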